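(* For every $R>0$ there is a positive constant $C_R$ depending only on $R$ such that, for all $d,N\in\mathbb{N}$, the following holds. Let $$\Theta_R=\Big\{\boldsymbol{p}\in(0,1)^d:\ \|\boldsymbol{p}\|_1<1\ \text{and}\ \frac{\max\{p_1,\dots,p_d,q\}}{\min\{p_1,\dots,p_d,q\}}\le R\Big\},\qquad q=1-\|\boldsymbol{p}\|_1,$$ and define the experiments $\mathscr{P}=\{\mathbb{P}_{N,\boldsymbol{p}}\}_{\boldsymbol{p}\in\Theta_R}$ and $\mathscr{Q}=\{\mathbb{Q}_{N,\boldsymbol{p}}\}_{\boldsymbol{p}\in\Theta_R}$, where $\mathbb{P}_{N,\boldsymbol{p}}$ is the measure induced by $\mathrm{Multinomial}(N,\boldsymbol{p})$ and $\mathbb{Q}_{N,\boldsymbol{p}}$ is the measure induced by $\mathrm{Normal}_d(N\boldsymbol{p},N\Sigma)$ with $\Sigma=\mathrm{diag}(\boldsymbol{p})-\boldsymbol{p}\boldsymbol{p}^\top$. Then the Le Cam distance between $\mathscr{P}$ and $\mathscr{Q}$ satisfies $$\Delta(\mathscr{P},\mathscr{Q})=\max\{\delta(\mathscr{P},\mathscr{Q}),\delta(\mathscr{Q},\mathscr{P})\}\le C_R\,\frac{d}{\sqrt N}.$$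
   Context: $\|\boldsymbol{x}\|_1=\sum_{i=1}^d|x_i|$. $\mathrm{Multinomial}(N,\boldsymbol{p})$ is the law on $N\mathcal{S}\cap\mathbb{N}_0^d=\{\boldsymbol{k}\in\mathbb{N}_0^d:\|\boldsymbol{k}\|_1\le N\}$ with mass function $\frac{N!}{(N-\|\boldsymbol{k}\|_1)!\prod_{i=1}^dk_i!}q^{N-\|\boldsymbol{k}\|_1}\prod_{i=1}^dp_i^{k_i}$, where $\mathcal{S}=\{\boldsymbol{s}\in[0,1]^d:\|\boldsymbol{s}\|_1\le1\}$. $\mathscr{B}(\cdot)$ denotes the Borel $\sigma$-algebra and $\|\cdot\|$ the total variation norm of signed measures. The deficiencies are $$\delta(\mathscr{P},\mathscr{Q})=\inf_{T_1}\sup_{\boldsymbol{p}\in\Theta_R}\Big\|\int_{N\mathcal{S}\cap\mathbb{N}_0^d}T_1(\boldsymbol{k},\cdot)\,\mathbb{P}_{N,\boldsymbol{p}}(d\boldsymbol{k})-\mathbb{Q}_{N,\boldsymbol{p}}\Big\|,$$ $$\delta(\mathscr{Q},\mathscr{P})=\inf_{T_2}\sup_{\boldsymbol{p}\in\Theta_R}\Big\|\mathbb{P}_{N,\boldsymbol{p}}-\int_{\mathbb{R}^d}T_2(\boldsymbol{y},\cdot)\,\mathbb{Q}_{N,\boldsymbol{p}}(d\boldsymbol{y})\Big\|,$$ where the infima are over all Markov kernels $T_1:(N\mathcal{S}\cap\mathbb{N}_0^d)\times\mathscr{B}(\mathbb{R}^d)\to[0,1]$ and $T_2:\mathbb{R}^d\times\mathscr{B}(N\mathcal{S}\cap\mathbb{N}_0^d)\to[0,1]$,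 respectively. *)

theory Defs
  imports
    "HOL-Probability.Probability"
    "Jordan_Normal_Form.Gauss_Jordan_Elimination"
    "Jordan_Normal_Form.Determinant"
begin

text \<open>
  As the dimension d has to range freely inside a formula, points of the d-dimensional real space
  are the extensional functions on the index set \<open>{..<d}\<close>.  The product \<open>\<sigma>\<close>-algebra below is its
  Borel \<open>\<sigma>\<close>-algebra.
\<close>

abbreviation Rd :: "nat \<Rightarrow> (nat \<Rightarrow> real) measure" where
  "Rd d \<equiv> Pi\<^sub>M {..<d} (\<lambda>_. borel)"

definition l1_norm :: "nat \<Rightarrow> (nat \<Rightarrow> real) \<Rightarrow> real" where
  "l1_norm d x = (\<Sum>i<d. \<bar>x i\<bar>)"

definition multinomial_grid :: "nat \<Rightarrow> nat \<Rightarrow> (nat \<Rightarrow> nat) set" where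
  "multinomial_grid d N = {k \<in> {..<d} \<rightarrow>\<^sub>E UNIV. (\<Sum>i<d. k i) \<le> N}"

definition multinomial_measure :: "nat \<Rightarrow> nat \<Rightarrow> (nat \<Rightarrow> real) \<Rightarrow> (nat \<Rightarrow> nat) measure" where
  "multinomial_measure d N p = point_measure (multinomial_grid d N) (\<lambda>k. ennreal
     (fact N / (fact (N - (\<Sum>i<d. k i)) * (\<Prod>i<d. fact (k i)))
       * (1 - l1_norm d p) ^ (N - (\<Sum>i<d. k i)) * (\<Prod>i<d. p i ^ k i)))"

text \<open>
  The normal law with mean \<open>\<mu>\<close> and covariance matrix \<open>S\<close>, for positive definite \<open>S\<close> only: for a
  singular \<open>S\<close> the inverse is an unspecified value.
\<close>

definition normal_measure :: "nat \<Rightarrow> (nat \<Rightarrow> real) \<Rightarrow> real mat \<Rightarrow> (nat \<Rightarrow> real) measure" where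
  "normal_measure d \<mu> S = density (Pi\<^sub>M {..<d} (\<lambda>_. lborel)) (\<lambda>x. ennreal
     (let v = Matrix.vec d (\<lambda>i. x i - \<mu> i) in
       exp (- (scalar_prod v (the (mat_inverse S) *\<^sub>v v)) / 2)
         / sqrt ((2 * pi) ^ d * Determinant.det S)))"

definition multinomial_cov :: "nat \<Rightarrow> (nat \<Rightarrow> real) \<Rightarrow> real mat" where
  "multinomial_cov d p = mat_diag d p - Matrix.mat d d (\<lambda>(i, j). p i * p j)"

definition Theta :: "nat \<Rightarrow> real \<Rightarrow> (nat \<Rightarrow> real) set" where
  "Theta d R = {p \<in> {..<d} \<rightarrow>\<^sub>E {0<..<1}. l1_norm d p < 1 \<and>
     Max (insert (1 - l1_norm d p) (p ` {..<d})) / Min (insert (1 - l1_norm d p) (p ` {..<d})) \<le> R}"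

text \<open>
  Total variation norm of a signed measure \<open>\<nu>\<close> on the \<open>\<sigma>\<close>-algebra of \<open>M\<close>: the total mass of its
  variation, so that the difference of two mutually singular probability measures has norm 2.
\<close>

definition tv_norm :: "'a measure \<Rightarrow> ('a set \<Rightarrow> real) \<Rightarrow> ennreal" where
  "tv_norm M \<nu> = (SUP \<A> \<in> {\<A>. finite \<A> \<and> \<A> \<subseteq> sets M \<and> partition_on (space M) \<A>}.
     \<Sum>A\<in>\<A>. ennreal \<bar>\<nu> A\<bar>)"

text \<open>
  The deficiency of the experiment \<open>P\<close> on \<open>M\<close> with respect to the experiment \<open>Q\<close> on \<open>K\<close>, both with
  parameter set \<open>\<Theta>\<close>.  Markov kernels are the measurable maps into the space of probability measures,
  and \<open>P \<theta> \<bind> T\<close> is the mixture of the kernel \<open>T\<close> by \<open>P \<theta>\<close>.  With values in \<open>ennreal\<close>, the supremum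
  over an empty parameter set is 0.
\<close>

definition deficiency ::
  "'p set \<Rightarrow> 'a measure \<Rightarrow> ('p \<Rightarrow> 'a measure) \<Rightarrow> 'b measure \<Rightarrow> ('p \<Rightarrow> 'b measure) \<Rightarrow> ennreal" where
  "deficiency \<Theta> M P K Q = (INF T \<in> M \<rightarrow>\<^sub>M prob_algebra K. SUP \<theta>\<in>\<Theta>.
     tv_norm K (\<lambda>A. measure (P \<theta> \<bind> T) A - measure (Q \<theta>) A))"

definition le_cam_distance ::
  "'p set \<Rightarrow> 'a measure \<Rightarrow> ('p \<Rightarrow> 'a measure) \<Rightarrow> 'b measure \<Rightarrow> ('p \<Rightarrow> 'b measure) \<Rightarrow> ennreal" where
  "le_cam_distance \<Theta> M P K Q = max (deficiency \<Theta> M P K Q) (deficiency \<Theta> K Q M P)"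

end

theory Submission
  imports Defs "HOL-Real_Asymp.Real_Asymp"
begin

text \<open>
  Adding independent uniform noise on $[-1/2,1/2)$ to each coordinate turns the multinomial vector
  into a law with a density \<open>f\<close> on $\mathbb{R}^d$, constant on unit cubes centred at the lattice
  points. Rounding undoes the noise, so the noise serves as the kernel in one direction, rounding
  as the kernel in the other, and both deficiencies are at most the \<open>L\<^sup>1\<close> distance between \<open>f\<close> and
  the normal density \<open>g\<close> (lemma \<open>le_cam_distance_le_histogram_L1\<close>).

  This distance is at most twice the square root of the relative entropy of \<open>f\<close> with respect to \<open>g\<close>
  (lemma \<open>integral_abs_diff_le_sqrt_entropy\<close>), and it suffices that the entropy is $O(d^2/N)$.
  Relative entropy is the right quantity here because it splits over coordinates: with the leftover
  count added as a cell of its own there are $d+1$ cells, and $\ln f$ is a constant plus a sum of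
  functions of single cell counts. The same holds for $\ln g$ averaged over a unit cube, since the
  quadratic form of the precision matrix is Pearson's statistic
  $\sum_i (k_i - N w_i)^2 / (N w_i)$ over all $d+1$ cells, and averaging only adds a constant of
  order $d^2/N$. So only the binomial marginals of the multinomial law matter.

  For a binomial count \<open>X\<close> with success probability \<open>w\<close> and mean $m = Nw$ the expectation of
  $\ln X!$ is at least $m \ln m - m + \frac12 \ln (2\pi m) + \frac12 (1-w) - 1/m$
  (lemma \<open>binomial_expectation_ln_fact_lower\<close>). Summed over the cells, all main terms cancel: the
  logarithms against $\ln N!$ and the normalising constant of \<open>g\<close>, and the terms $\frac12(1 - w_i)$
  against the expectation \<open>d\<close> of Pearson's statistic. What is left is of the order of
  $\sum_i 1/(N w_i)$, and this is at most $R(d+1)^2/N$ because every cell probability is at least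
  $1/(R(d+1))$.
\<close>

section \<open>Stirling's formula around half-integers\<close>

text \<open>
  The logarithm of $k!$ compared with the integral of $\ln$ over $[0, k + \frac12]$. Centring at
  $k + \frac12$ rather than at \<open>k\<close> absorbs the term $\frac12 \ln k$, so that nothing is singular at
  $k = 0$.
\<close>

definition stirling_defect :: "nat \<Rightarrow> real" where
  "stirling_defect k = ln (fact k) - ((k + 1/2) * ln (k + 1/2) - (k + 1/2))"

text \<open>
  The derivative of the middle expression in \<open>s\<close> is $-\ln(1 - s^2)$, which lies between 0 and
  $\frac43 s^2$ on the given interval.
\<close>

lemma xlnx_sym_difference_bounds:
  fixes s :: real
  assumes "0 \<le> s" "s \<le> 1/2"
  shows "0 \<le> 2 * s - (1 + s) * ln (1 + s) + (1 - s) * ln (1 - s)"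
    and "2 * s - (1 + s) * ln (1 + s) + (1 - s) * ln (1 - s) \<le> 4/9 * s ^ 3"
proof -
  define \<psi> where "\<psi> = (\<lambda>s::real. 2 * s - (1 + s) * ln (1 + s) + (1 - s) * ln (1 - s))"
  have d: "(\<psi> has_real_derivative - ln (1 - u\<^sup>2)) (at u)" if "0 \<le> u" "u \<le> s" for u
  proof -
    have "1 - u\<^sup>2 = (1 + u) * (1 - u)" by (simp add: power2_eq_square algebra_simps)
    then have "ln (1 - u\<^sup>2) = ln (1 + u) + ln (1 - u)" using that assms by (simp add: ln_mult)
    moreover have "(\<psi> has_real_derivative
        2 - (1 * ln (1 + u) + (1 + u) * (1 / (1 + u))) + (- 1 * ln (1 - u) + (1 - u) * (- 1 / (1 - u)))) (at u)"
      unfolding \<psi>_def using that assms by (auto intro!: derivative_eq_intros)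
    ultimately show ?thesis using that assms by simp
  qed
  have sq: "u\<^sup>2 \<le> 1/4" if "0 \<le> u" "u \<le> s" for u
  proof -
    have "u\<^sup>2 \<le> (1/2)\<^sup>2" using that assms by (intro power_mono) auto
    then show ?thesis by (simp add: power2_eq_square)
  qed
  have "\<psi> 0 \<le> \<psi> s"
  proof (rule DERIV_nonneg_imp_nondecreasing[OF assms(1)])
    fix u assume u: "0 \<le> u" "u \<le> s"
    have "0 \<le> - ln (1 - u\<^sup>2)" using sq[OF u] by (simp add: ln_le_zero_iff)
    then show "\<exists>y. (\<psi> has_real_derivative y) (at u) \<and> 0 \<le> y" using d[OF u] by blast
  qed
  then show "0 \<le> 2 * s - (1 + s) * ln (1 + s) + (1 - s) * ln (1 - s)" by (simp add: \<psi>_def)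
  have "4/9 * 0 ^ 3 - \<psi> 0 \<le> 4/9 * s ^ 3 - \<psi> s"
  proof (rule DERIV_nonneg_imp_nondecreasing[OF assms(1)])
    fix u assume u: "0 \<le> u" "u \<le> s"
    have "ln (1 / (1 - u\<^sup>2)) \<le> 1 / (1 - u\<^sup>2) - 1"
      using sq[OF u] by (intro ln_le_minus_one) auto
    also have "\<dots> = u\<^sup>2 * (1 / (1 - u\<^sup>2))" using sq[OF u] by (simp add: field_simps)
    also have "\<dots> \<le> u\<^sup>2 * (4/3)" using sq[OF u] by (intro mult_left_mono) (auto simp: field_simps)
    finally have "- ln (1 - u\<^sup>2) \<le> 4/3 * u\<^sup>2" using sq[OF u] by (simp add: ln_div)
    moreover have "((\<lambda>s. 4/9 * s ^ 3 - \<psi> s) has_real_derivative 4/3 * u\<^sup>2 - (- ln (1 - u\<^sup>2))) (at u)"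
      by (rule derivative_eq_intros d[OF u] refl | simp)+
    ultimately show "\<exists>y. ((\<lambda>s. 4/9 * s ^ 3 - \<psi> s) has_real_derivative y) (at u) \<and> 0 \<le> y" by force
  qed
  then show "2 * s - (1 + s) * ln (1 + s) + (1 - s) * ln (1 - s) \<le> 4/9 * s ^ 3" by (simp add: \<psi>_def)
qed

text \<open>
  The increment is $\ln x$ minus its mean over the unit interval around $x = k + 1$: nonnegative by
  concavity, and of order $1/x^2$, for which a telescoping bound is available.
\<close>

lemma stirling_defect_step:
  "0 \<le> stirling_defect (Suc k) - stirling_defect k"
  "stirling_defect (Suc k) - stirling_defect k \<le> 1/18 * (1 / (k + 1/2) - 1 / (Suc k + 1/2))"
proof -
  define x where "x = real k + 1"
  define s where "s = 1 / (2 * x)"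
  have x: "x \<ge> 1" by (simp add: x_def)
  have s: "0 \<le> s" "s \<le> 1/2" "s > 0" using x by (auto simp: s_def field_simps)
  have xs: "x * s = 1/2" using x by (simp add: s_def)
  have u: "real k + 3/2 = x * (1 + s)" "real k + 1/2 = x * (1 - s)"
    using xs by (auto simp: algebra_simps x_def)
  have l: "ln (real k + 3/2) = ln x + ln (1 + s)" "ln (real k + 1/2) = ln x + ln (1 - s)"
    unfolding u using x s by (auto simp: ln_mult)
  have "fact (Suc k) = x * fact k" by (simp add: x_def)
  then have lf: "ln (fact (Suc k) :: real) = ln x + ln (fact k)" using x by (simp add: ln_mult del: fact_Suc)
  have sk: "real (Suc k) + 1/2 = real k + 3/2" by simp
  have "stirling_defect (Suc k) - stirling_defect k
      = ln x - (real k + 3/2) * ln (real k + 3/2) + (real k + 1/2) * ln (real k + 1/2) + 1"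
    unfolding stirling_defect_def lf sk by (simp add: algebra_simps)
  also have "\<dots> = 1 - x * ((1 + s) * ln (1 + s) - (1 - s) * ln (1 - s)) + ln x * (1 - 2 * (x * s))"
    unfolding l unfolding u by (simp add: algebra_simps)
  also have "\<dots> = 2 * (x * s) - x * ((1 + s) * ln (1 + s) - (1 - s) * ln (1 - s))"
    unfolding xs by simp
  also have "\<dots> = x * (2 * s - (1 + s) * ln (1 + s) + (1 - s) * ln (1 - s))" by (simp add: algebra_simps)
  finally have eq: "stirling_defect (Suc k) - stirling_defect k
      = x * (2 * s - (1 + s) * ln (1 + s) + (1 - s) * ln (1 - s))" .
  show "0 \<le> stirling_defect (Suc k) - stirling_defect k"
    unfolding eq using xlnx_sym_difference_bounds(1)[OF s(1,2)] x by simp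
  have "x * (2 * s - (1 + s) * ln (1 + s) + (1 - s) * ln (1 - s)) \<le> x * (4/9 * s ^ 3)"
    using xlnx_sym_difference_bounds(2)[OF s(1,2)] x by (intro mult_left_mono) auto
  also have "\<dots> = 1/18 * (1 / x\<^sup>2)" using x by (simp add: s_def field_simps power2_eq_square power3_eq_cube)
  also have "\<dots> \<le> 1/18 * (1 / (x\<^sup>2 - 1/4))"
  proof -
    have "x\<^sup>2 \<ge> 1" using x by simp
    then show ?thesis by (intro mult_left_mono divide_left_mono mult_pos_pos) auto
  qed
  also have "1 / (x\<^sup>2 - 1/4) = 1 / (k + 1/2) - 1 / (Suc k + 1/2)"
  proof -
    have "x\<^sup>2 - 1/4 = (real k + 1/2) * (real (Suc k) + 1/2)"
      by (simp add: x_def power2_eq_square algebra_simps)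
    moreover have "1 / (real k + 1/2) - 1 / (real (Suc k) + 1/2) = 1 / ((real k + 1/2) * (real (Suc k) + 1/2))"
    proof -
      have "1 / a - 1 / (a + 1) = 1 / (a * (a + 1))" if "a > 0" for a :: real
        using that by (simp add: field_simps)
      from this[of "real k + 1/2"] show ?thesis by (simp add: add_ac)
    qed
    ultimately show ?thesis by simp
  qed
  finally show "stirling_defect (Suc k) - stirling_defect k \<le> 1/18 * (1 / (k + 1/2) - 1 / (Suc k + 1/2))"
    unfolding eq .
qed

lemma wallis_product_fact:
  "(\<Prod>k=1..n. (4*real k^2) / (4*real k^2 - 1)) = (4 ^ n * (fact n)\<^sup>2)\<^sup>2 / ((fact (2 * n))\<^sup>2 * (2 * n + 1))"
proof (induction n)
  case (Suc n)
  have f: "fact (2 * Suc n) = (2 * real n + 2) * (2 * real n + 1) * fact (2 * n)"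
    by (simp add: algebra_simps)
  have g: "4 * (real (Suc n))\<^sup>2 - 1 = (2 * real n + 1) * (2 * real n + 3)"
    by (simp add: power2_eq_square algebra_simps)
  have fn: "(fact (2 * n) :: real) \<noteq> 0" "2 * real n + 1 \<noteq> 0" "2 * real n + 3 \<noteq> 0" "real n + 1 \<noteq> 0"
    by (auto simp: add_eq_0_iff)
  define a where "a = (fact (2*n) :: real)"
  define b where "b = (fact n :: real)"
  define c where "c = (4::real) ^ n"
  define z where "z = real n"
  have fn: "a \<noteq> 0" "2 * z + 1 \<noteq> 0" "2 * z + 3 \<noteq> 0" "z + 1 \<noteq> 0" 
    using fn by (auto simp: a_def z_def)
  have "(\<Prod>k=1..Suc n. (4*real k^2) / (4*real k^2 - 1))
     = (c * b\<^sup>2)\<^sup>2 / (a\<^sup>2 * (2 * z + 1)) * ((4 * (z + 1)\<^sup>2) / ((2 * z + 1) * (2 * z + 3)))"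
    using Suc.IH g unfolding a_def b_def c_def z_def
    by (subst prod.nat_ivl_Suc') (simp_all add: add.commute mult.commute mult.left_commute)
  also have "\<dots> = (4 * c * ((z + 1) * b)\<^sup>2)\<^sup>2 / (((2 * z + 2) * (2 * z + 1) * a)\<^sup>2 * (2 * z + 3))"
    using fn by (simp add: divide_simps) (simp add: power2_eq_square power4_eq_xxxx algebra_simps)
  finally show ?case unfolding f by (simp add: a_def b_def c_def z_def add_ac)
qed simp

text \<open>
  The defect increases and is bounded, hence converges. Wallis' product is the exponential of
  \<open>4 * stirling_defect n - 2 * stirling_defect (2 * n)\<close> up to an explicit factor, and so identifies
  the limit.
\<close>

lemma stirling_defect_tendsto: "stirling_defect \<longlonglongrightarrow> ln (2 * pi) / 2"
proof -
  have inc: "incseq stirling_defect"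
    using stirling_defect_step(1) by (intro incseq_SucI) (simp add: algebra_simps)
  have dec: "decseq (\<lambda>k. stirling_defect k + 1/18 * (1 / (k + 1/2)))"
    using stirling_defect_step(2) by (intro decseq_SucI) (simp add: algebra_simps)
  have "stirling_defect k \<le> stirling_defect 0 + 1/18 * (1 / (0 + 1/2))" for k
  proof -
    have "0 \<le> 1/18 * (1 / (real k + 1/2))" by simp
    moreover have "stirling_defect k + 1/18 * (1 / (k + 1/2)) \<le> stirling_defect 0 + 1/18 * (1 / (0 + 1/2))"
      using decseqD[OF dec, of 0 k] by simp
    ultimately show ?thesis by linarith
  qed
  then obtain \<kappa> where \<kappa>: "stirling_defect \<longlonglongrightarrow> \<kappa>"
    using incseq_convergent[OF inc] by metis
  \<comment> \<open>The logarithm of Wallis' product without the defects.\<close>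
  define r where "r = (\<lambda>n::nat. 4 * n * ln 2 + 4 * ((n + 1/2) * ln (n + 1/2) - (n + 1/2))
     - 2 * ((2 * n + 1/2) * ln (2 * n + 1/2) - (2 * n + 1/2)) - ln (2 * n + 1) :: real)"
  have r: "r \<longlonglongrightarrow> - 2 * ln 2" unfolding r_def by real_asymp
  have \<kappa>2: "(\<lambda>n. stirling_defect (2 * n)) \<longlonglongrightarrow> \<kappa>"
    using LIMSEQ_subseq_LIMSEQ[OF \<kappa>, of "\<lambda>n. 2 * n"] by (simp add: strict_mono_def comp_def)
  have w: "(\<Prod>k=1..n. (4*real k^2) / (4*real k^2 - 1))
      = exp (4 * stirling_defect n - 2 * stirling_defect (2 * n) + r n)" for n
  proof -
    have "ln ((4 ^ n * (fact n)\<^sup>2)\<^sup>2 / ((fact (2 * n))\<^sup>2 * (2 * real n + 1)))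
       = 4 * n * ln 2 + 4 * ln (fact n) - 2 * ln (fact (2 * n)) - ln (2 * n + 1)"
    proof -
      have "ln (4::real) = 2 * ln 2" using ln_realpow[of 2 2] by simp
      then show ?thesis by (simp add: ln_div ln_mult ln_realpow)
    qed
    also have "\<dots> = 4 * stirling_defect n - 2 * stirling_defect (2 * n) + r n"
      by (simp add: stirling_defect_def r_def algebra_simps)
    finally show ?thesis unfolding wallis_product_fact
      by (subst exp_ln[symmetric]) (auto simp: add_ac)
  qed
  have "(\<lambda>n. exp (4 * stirling_defect n - 2 * stirling_defect (2 * n) + r n))
      \<longlonglongrightarrow> exp (4 * \<kappa> - 2 * \<kappa> + - 2 * ln 2)"
    by (intro tendsto_intros \<kappa> \<kappa>2 r)
  then have "exp (4 * \<kappa> - 2 * \<kappa> + - 2 * ln 2) = pi / 2"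
    using wallis unfolding w by (rule LIMSEQ_unique)
  then have "4 * \<kappa> - 2 * \<kappa> + - 2 * ln 2 = ln (pi / 2)" by (metis ln_exp)
  then have "\<kappa> = ln (2 * pi) / 2" by (simp add: ln_div ln_mult)
  with \<kappa> show ?thesis by simp
qed

lemma stirling_defect_bounds:
  "stirling_defect k \<le> ln (2 * pi) / 2"
  "ln (2 * pi) / 2 - 1/18 * (1 / (k + 1/2)) \<le> stirling_defect k"
proof -
  have inc: "incseq stirling_defect"
    using stirling_defect_step(1) by (intro incseq_SucI) (simp add: algebra_simps)
  show "stirling_defect k \<le> ln (2 * pi) / 2" by (rule incseq_le[OF inc stirling_defect_tendsto])
  have dec: "decseq (\<lambda>k. stirling_defect k + 1/18 * (1 / (k + 1/2)))"
    using stirling_defect_step(2) by (intro decseq_SucI) (simp add: algebra_simps)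
  have "(\<lambda>k. 1/18 * (1 / (real k + 1/2))) \<longlonglongrightarrow> 0" by real_asymp
  from tendsto_add[OF stirling_defect_tendsto this]
  have "(\<lambda>k. stirling_defect k + 1/18 * (1 / (k + 1/2))) \<longlonglongrightarrow> ln (2 * pi) / 2" by simp
  from decseq_ge[OF dec this, of k]
  show "ln (2 * pi) / 2 - 1/18 * (1 / (k + 1/2)) \<le> stirling_defect k" by simp
qed

lemma ln_fact_upper:
  assumes "N \<ge> 1"
  shows "ln (fact N) \<le> N * ln N - N + ln N / 2 + ln (2 * pi) / 2 + 1 / (4 * N)"
proof -
  have n: "real N > 0" using assms by simp
  have "real N + 1/2 = N * (1 + 1 / (2 * N))" using n by (simp add: field_simps)
  moreover have "0 < 1 + 1 / (2 * real N)" using n by (intro add_pos_nonneg) auto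
  ultimately have "ln (N + 1/2) = ln N + ln (1 + 1 / (2 * N))" using n by (simp only: ln_mult_pos)
  also have "\<dots> \<le> ln N + 1 / (2 * N)" using ln_add_one_self_le_self[of "1 / (2 * N)"] by simp
  finally have "(N + 1/2) * ln (N + 1/2) \<le> (N + 1/2) * (ln N + 1 / (2 * N))" using n by simp
  also have "\<dots> = N * ln N + ln N / 2 + 1/2 + 1 / (4 * N)" using n by (simp add: field_simps)
  finally show ?thesis using stirling_defect_bounds(1)[of N] unfolding stirling_defect_def by simp
qed

text \<open>
  The Taylor polynomial of degree three is a lower bound on the whole domain, since the second
  derivative of the difference is $t^2/(1+t) \ge 0$.
\<close>

lemma one_plus_ln_cubic_lower:
  fixes t :: real
  assumes t: "t > -1"
  shows "t + t\<^sup>2 / 2 - t ^ 3 / 6 \<le> (1 + t) * ln (1 + t)"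
proof -
  define h where "h = (\<lambda>t::real. (1 + t) * ln (1 + t) - t - t\<^sup>2 / 2 + t ^ 3 / 6)"
  define h' where "h' = (\<lambda>t::real. ln (1 + t) - t + t\<^sup>2 / 2)"
  have d: "(h has_real_derivative h' u) (at u)" if "u > -1" for u
  proof -
    have "(h has_real_derivative (1 * ln (1 + u) + (1 + u) * (1 / (1 + u))) - 1 - u + u\<^sup>2 / 2) (at u)"
      unfolding h_def using that by (auto intro!: derivative_eq_intros)
    then show ?thesis using that by (simp add: h'_def)
  qed
  have d': "(h' has_real_derivative u\<^sup>2 / (1 + u)) (at u)" if "u > -1" for u
    unfolding h'_def using that
    by (auto intro!: derivative_eq_intros simp: field_simps power2_eq_square)
  have mono': "h' a \<le> h' b" if ab: "-1 < a" "a \<le> b" for a b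
  proof (rule DERIV_nonneg_imp_nondecreasing[OF ab(2)])
    fix u assume "a \<le> u" "u \<le> b"
    then have "-1 < u" using ab by simp
    then show "\<exists>y. (h' has_real_derivative y) (at u) \<and> 0 \<le> y"
      using d'[of u] by (intro exI[of _ "u\<^sup>2 / (1 + u)"]) auto
  qed
  have "h 0 \<le> h t"
  proof (cases "t \<ge> 0")
    case True
    have "0 \<le> h' u" if "0 \<le> u" for u using mono'[of 0 u] that by (simp add: h'_def)
    then show ?thesis using d
      by (intro DERIV_nonneg_imp_nondecreasing[OF True]) (auto intro!: exI[of _ "h' _"])
  next
    case False
    have "h' u \<le> 0" if "-1 < u" "u \<le> 0" for u using mono'[of u 0] that by (simp add: h'_def)
    moreover have "t \<le> 0" using False by simp
    ultimately show ?thesis using d t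
      by (intro DERIV_nonpos_imp_nonincreasing[of t 0 h]) (force intro!: exI)+
  qed
  then show ?thesis by (simp add: h_def)
qed

lemma xlnx_cubic_lower:
  fixes x M :: real
  assumes "x > 0" "M > 0"
  shows "M * ln M + (1 + ln M) * (x - M) + (x - M)\<^sup>2 / (2 * M) - (x - M) ^ 3 / (6 * M\<^sup>2) \<le> x * ln x"
proof -
  define t where "t = x / M - 1"
  have t: "t > -1" "x = M * (1 + t)" using assms by (auto simp: t_def field_simps)
  have l: "ln x = ln M + ln (1 + t)" using t assms by (simp add: ln_mult)
  have "M * (t + t\<^sup>2 / 2 - t ^ 3 / 6) \<le> M * ((1 + t) * ln (1 + t))"
    using one_plus_ln_cubic_lower[OF t(1)] assms by simp
  moreover have "x - M = M * t" using t by (simp add: algebra_simps)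
  moreover have "(M * t)\<^sup>2 / (2 * M) - (M * t) ^ 3 / (6 * M\<^sup>2) = M * (t\<^sup>2 / 2 - t ^ 3 / 6)"
    using assms by (simp add: field_simps power2_eq_square power3_eq_cube)
  ultimately show ?thesis unfolding l using t(2)
    by (simp add: algebra_simps)
qed

text \<open>
  A lower bound of $\ln k!$ by a cubic polynomial in $k - m$ plus a multiple of $1/(k+1)$, all of
  whose expectations under a binomial law are explicit. It holds for every \<open>k\<close>, however far from
  \<open>m\<close>, so expectations can be taken term by term. The expansion point is $m + \frac12$, to match Stirling's formula at
  $k + \frac12$.
\<close>

lemma ln_fact_cubic_lower:
  fixes m :: real and k :: nat
  assumes "m > 0"
  shows "m * ln m - m + ln m / 2 + ln (2 * pi) / 2 + ln (m + 1/2) * (k - m)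
      + (k - m)\<^sup>2 / (2 * (m + 1/2)) - (k - m) ^ 3 / (6 * (m + 1/2)\<^sup>2) - (1/9) * (1 / (k + 1)) \<le> ln (fact k)"
proof -
  let ?M = "m + 1/2"
  have e: "k + 1/2 - ?M = k - m" by simp
  have 1: "?M * ln ?M + (1 + ln ?M) * (k - m) + (k - m)\<^sup>2 / (2 * ?M) - (k - m) ^ 3 / (6 * ?M\<^sup>2)
     \<le> (k + 1/2) * ln (k + 1/2)"
    using xlnx_cubic_lower[of "k + 1/2" ?M] assms unfolding e by simp
  have 2: "m * ln m + ln m / 2 + 1/2 \<le> ?M * ln ?M"
  proof -
    have "ln (m / ?M) \<le> m / ?M - 1" using assms by (intro ln_le_minus_one) auto
    also have "m / ?M - 1 = - (1/2) / ?M" using assms by (simp add: field_simps)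
    finally have "ln m - ln ?M \<le> - (1/2) / ?M" using assms by (simp add: ln_div)
    then have "?M * (ln m - ln ?M) \<le> ?M * (- (1/2) / ?M)" using assms by (intro mult_left_mono) auto
    also have "\<dots> = - (1/2)" using assms by simp
    finally show ?thesis by (simp add: algebra_simps)
  qed
  have "1/18 * (1 / (real k + 1/2)) \<le> 1/18 * (2 / (real k + 1))"
    by (intro mult_left_mono) (auto simp: divide_simps)
  then have 3: "ln (2 * pi) / 2 - (1/9) * (1 / (k + 1)) \<le> stirling_defect k"
    using stirling_defect_bounds(2)[of k] by (simp add: algebra_simps)
  show ?thesis using 1 2 3 unfolding stirling_defect_def by (simp add: algebra_simps)
qed

section \<open>Binomial expectations\<close>

text \<open>
  Size biasing of the binomial law. It yields the factorial moments, and with $h(k) = 1/k$ the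
  expectation of $1/(X+1)$.
\<close>

lemma sum_Bernstein_mult_index:
  fixes x :: real and h :: "nat \<Rightarrow> real"
  shows "(\<Sum>k\<le>Suc n. Bernstein (Suc n) k x * (k * h k)) = Suc n * x * (\<Sum>k\<le>n. Bernstein n k x * h (Suc k))"
proof -
  have "(\<Sum>k\<le>Suc n. Bernstein (Suc n) k x * (k * h k))
      = (\<Sum>k\<le>n. Bernstein (Suc n) (Suc k) x * (Suc k * h (Suc k)))"
    unfolding sum.atMost_Suc_shift by simp
  also have "\<dots> = (\<Sum>k\<le>n. Suc n * x * (Bernstein n k x * h (Suc k)))"
  proof (rule sum.cong[OF refl])
    fix k
    have c: "real (Suc n choose Suc k) * Suc k = Suc n * real (n choose k)"
      using arg_cong[OF Suc_times_binomial[of k n], of real]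
      by (simp only: of_nat_mult mult.commute)
    have "Bernstein (Suc n) (Suc k) x * (Suc k * h (Suc k))
        = (real (Suc n choose Suc k) * Suc k) * (x * x ^ k * (1 - x) ^ (n - k) * h (Suc k))"
      unfolding Bernstein_def power_Suc diff_Suc_Suc by (simp only: mult_ac)
    also have "\<dots> = Suc n * x * (Bernstein n k x * h (Suc k))"
      unfolding c Bernstein_def by (simp only: mult_ac)
    finally show "Bernstein (Suc n) (Suc k) x * (Suc k * h (Suc k)) = Suc n * x * (Bernstein n k x * h (Suc k))" .
  qed
  finally show ?thesis by (simp only: sum_distrib_left)
qed

lemma sum_kkk_Bernstein:
  "(\<Sum>k\<le>n. Bernstein n k x * (real k * ((real k - 1) * (real k - 2)))) = real n * (real n - 1) * (real n - 2) * x ^ 3"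
proof (cases n)
  case (Suc m)
  have "(\<Sum>k\<le>n. Bernstein n k x * (real k * ((real k - 1) * (real k - 2))))
     = n * x * (\<Sum>k\<le>m. Bernstein m k x * (real k * (real k - 1)))"
    unfolding Suc by (subst sum_Bernstein_mult_index) (simp add: algebra_simps)
  also have "(\<Sum>k\<le>m. Bernstein m k x * (real k * (real k - 1))) = real m * (real m - 1) * x\<^sup>2"
    using sum_kk_Bernstein[of m x] by (simp add: mult_ac)
  finally show ?thesis by (simp add: Suc power2_eq_square power3_eq_cube algebra_simps)
qed simp

lemma Bernstein_central_moments:
  fixes x m :: real and n :: nat
  defines "m \<equiv> n * x"
  shows "(\<Sum>k\<le>n. Bernstein n k x * (k - m)) = 0"
    and "(\<Sum>k\<le>n. Bernstein n k x * (k - m)\<^sup>2) = m * (1 - x)"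
    and "(\<Sum>k\<le>n. Bernstein n k x * (k - m) ^ 3) = m * (1 - x) * (1 - 2 * x)"
proof -
  have s0: "(\<Sum>k\<le>n. Bernstein n k x) = 1" by (rule sum_Bernstein)
  have s1: "(\<Sum>k\<le>n. Bernstein n k x * real k) = n * x" using sum_k_Bernstein[of n x] by (simp add: mult.commute)
  have s2: "(\<Sum>k\<le>n. Bernstein n k x * (real k * (real k - 1))) = real n * (real n - 1) * x\<^sup>2"
    using sum_kk_Bernstein[of n x] by (simp add: mult_ac)
  note s3 = sum_kkk_Bernstein[of n x]
  have "(\<Sum>k\<le>n. Bernstein n k x * (k - m)) = (\<Sum>k\<le>n. Bernstein n k x * real k + (- m) * Bernstein n k x)"
    by (intro sum.cong refl) (simp add: algebra_simps)
  then show "(\<Sum>k\<le>n. Bernstein n k x * (k - m)) = 0"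
    by (simp only: sum.distrib sum_distrib_left[symmetric] s0 s1) (simp add: m_def)
  have "(\<Sum>k\<le>n. Bernstein n k x * (k - m)\<^sup>2) = (\<Sum>k\<le>n. Bernstein n k x * (real k * (real k - 1))
     + (1 - 2 * m) * (Bernstein n k x * real k) + m\<^sup>2 * Bernstein n k x)"
    by (intro sum.cong refl) (simp add: algebra_simps power2_eq_square)
  then show "(\<Sum>k\<le>n. Bernstein n k x * (k - m)\<^sup>2) = m * (1 - x)"
    by (simp only: sum.distrib sum_distrib_left[symmetric] s0 s1 s2)
       (simp add: m_def algebra_simps power2_eq_square)
  have "(\<Sum>k\<le>n. Bernstein n k x * (k - m) ^ 3) = (\<Sum>k\<le>n. Bernstein n k x * (real k * ((real k - 1) * (real k - 2)))
     + (3 - 3 * m) * (Bernstein n k x * (real k * (real k - 1)))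
     + (1 - 3 * m + 3 * m\<^sup>2) * (Bernstein n k x * real k) + (- (m ^ 3)) * Bernstein n k x)"
    by (intro sum.cong refl) (simp add: algebra_simps power2_eq_square power3_eq_cube)
  then show "(\<Sum>k\<le>n. Bernstein n k x * (k - m) ^ 3) = m * (1 - x) * (1 - 2 * x)"
    by (simp only: sum.distrib sum_distrib_left[symmetric] s0 s1 s2 s3)
       (simp add: m_def algebra_simps power2_eq_square power3_eq_cube)
qed

lemma Bernstein_inverse_moment:
  fixes x :: real and n :: nat
  assumes "0 \<le> x" "x \<le> 1"
  shows "(n + 1) * x * (\<Sum>k\<le>n. Bernstein n k x * (1 / (k + 1))) \<le> 1"
proof -
  have "(n + 1) * x * (\<Sum>k\<le>n. Bernstein n k x * (1 / (k + 1)))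
     = (\<Sum>k\<le>Suc n. Bernstein (Suc n) k x * (k * (1 / k)))"
    by (subst sum_Bernstein_mult_index) (simp add: add_ac)
  also have "\<dots> \<le> (\<Sum>k\<le>Suc n. Bernstein (Suc n) k x)"
    using assms by (intro sum_mono mult_left_le) (auto simp: Bernstein_nonneg)
  finally show ?thesis by (simp add: sum_Bernstein)
qed

text \<open>
  The quadratic term of the cubic bound contributes $\frac12(1-x)$, the cubic one is of order
  $1/m$ because the third central moment of a binomial law is at most its mean.
\<close>

lemma binomial_expectation_ln_fact_lower:
  fixes x m :: real and n :: nat
  assumes x: "0 < x" "x < 1" and n: "n \<ge> 1"
  defines "m \<equiv> n * x"
  shows "m * ln m - m + ln m / 2 + ln (2 * pi) / 2 + (1 - x) / 2 - 1 / m
    \<le> (\<Sum>k\<le>n. Bernstein n k x * ln (fact k))"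
proof -
  let ?B = "\<lambda>k. Bernstein n k x"
  let ?M = "m + 1/2"
  have m: "m > 0" using assms by simp
  define c where "c = m * ln m - m + ln m / 2 + ln (2 * pi) / 2"
  note mom = Bernstein_central_moments[of n x, folded m_def]
  have "c + m * (1 - x) / (2 * ?M) - m * (1 - x) * (1 - 2 * x) / (6 * ?M\<^sup>2)
      - (1/9) * (\<Sum>k\<le>n. ?B k * (1 / (k + 1)))
    = (\<Sum>k\<le>n. c * ?B k + ln ?M * (?B k * (k - m)) + 1 / (2 * ?M) * (?B k * (k - m)\<^sup>2)
        + (- 1 / (6 * ?M\<^sup>2)) * (?B k * (k - m) ^ 3) + (- 1/9) * (?B k * (1 / (k + 1))))"
    unfolding sum.distrib sum_distrib_left[symmetric] mom sum_Bernstein by simp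
  also have "\<dots> = (\<Sum>k\<le>n. ?B k * (c + ln ?M * (k - m)
      + (k - m)\<^sup>2 / (2 * ?M) - (k - m) ^ 3 / (6 * ?M\<^sup>2) - (1/9) * (1 / (k + 1))))"
    by (intro sum.cong refl) (simp add: algebra_simps)
  also have "\<dots> \<le> (\<Sum>k\<le>n. ?B k * ln (fact k))"
    using x ln_fact_cubic_lower[OF m] unfolding c_def by (intro sum_mono mult_left_mono) (auto simp: Bernstein_nonneg)
  finally have main: "c + m * (1 - x) / (2 * ?M) - m * (1 - x) * (1 - 2 * x) / (6 * ?M\<^sup>2)
      - (1/9) * (\<Sum>k\<le>n. ?B k * (1 / (k + 1))) \<le> (\<Sum>k\<le>n. ?B k * ln (fact k))" .
  have "(1 - x) / 2 - m * (1 - x) / (2 * ?M) = (1 - x) / (4 * m + 2)" using m by (simp add: field_simps)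
  also have "\<dots> \<le> 1 / (4 * m)" using m x by (intro frac_le) auto
  finally have 1: "(1 - x) / 2 - 1 / (4 * m) \<le> m * (1 - x) / (2 * ?M)" by simp
  have "m * ((1 - x) * (1 - 2 * x)) \<le> m * 1"
  proof -
    have "(1 - x) * (1 - 2 * x) \<le> 1" using x by (simp add: algebra_simps)
    then show ?thesis using m by simp
  qed
  then have "m * (1 - x) * (1 - 2 * x) / (6 * ?M\<^sup>2) \<le> m / (6 * m\<^sup>2)"
    using m by (intro frac_le mult_left_mono power_mono) (auto simp: mult.assoc)
  then have 2: "m * (1 - x) * (1 - 2 * x) / (6 * ?M\<^sup>2) \<le> 1 / (6 * m)"
    using m by (simp add: power2_eq_square)
  have 3: "(\<Sum>k\<le>n. ?B k * (1 / (k + 1))) \<le> 1 / m"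
  proof -
    have nn: "0 \<le> (\<Sum>k\<le>n. ?B k * (1 / (k + 1)))" using x by (intro sum_nonneg) (auto simp: Bernstein_nonneg)
    have "m * (\<Sum>k\<le>n. ?B k * (1 / (k + 1))) \<le> (n + 1) * x * (\<Sum>k\<le>n. ?B k * (1 / (k + 1)))"
      using x nn unfolding m_def by (intro mult_right_mono) auto
    also have "\<dots> \<le> 1" using x by (intro Bernstein_inverse_moment) auto
    finally show ?thesis using m by (simp add: field_simps)
  qed
  have "1 / (4 * m) + 1 / (6 * m) + (1/9) * (1 / m) \<le> 1 / m" using m by (simp add: field_simps)
  with main 1 2 3 show ?thesis unfolding c_def by linarith
qed

section \<open>The multinomial law and its marginals\<close>

definition compositions :: "'i set \<Rightarrow> nat \<Rightarrow> ('i \<Rightarrow> nat) set" where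
  "compositions I n = {k \<in> I \<rightarrow>\<^sub>E UNIV. (\<Sum>i\<in>I. k i) = n}"

lemma finite_compositions [simp]:
  assumes "finite I"
  shows "finite (compositions I n)"
proof (rule finite_subset)
  show "compositions I n \<subseteq> I \<rightarrow>\<^sub>E {..n}"
    using assms by (auto simp: compositions_def PiE_def Pi_def intro: member_le_sum)
  show "finite (I \<rightarrow>\<^sub>E {..n})" using assms by (intro finite_PiE) auto
qed

lemma compositions_empty: "compositions {} n = (if n = 0 then {\<lambda>_. undefined} else {})"
  by (auto simp: compositions_def)

text \<open>
  Splitting off one coordinate. Both the multinomial theorem and the computation of the marginals
  rest on this identity.
\<close>

lemma sum_compositions_insert:
  assumes "finite I" "i \<notin> I"
  shows "(\<Sum>k\<in>compositions (insert i I) n. F k) = (\<Sum>j\<le>n. \<Sum>k\<in>compositions I (n - j). F (k(i := j)))"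
proof -
  have s: "(\<Sum>l\<in>I. (k(i := j)) l) = (\<Sum>l\<in>I. k l)" for k :: "'a \<Rightarrow> nat" and j
    using assms by (intro sum.cong) auto
  have "(\<Sum>k\<in>compositions (insert i I) n. F k)
      = (\<Sum>(j, k)\<in>Sigma {..n} (\<lambda>j. compositions I (n - j)). F (k(i := j)))"
  proof (rule sum.reindex_bij_witness[where i = "\<lambda>(j, k). k(i := j)" and j = "\<lambda>k. (k i, k(i := undefined))"])
    fix k assume k: "k \<in> compositions (insert i I) n"
    then have "k i + (\<Sum>l\<in>I. k l) = n" using assms by (simp add: compositions_def)
    moreover have "k(i := undefined) \<in> I \<rightarrow>\<^sub>E UNIV"
      using k assms by (auto simp: compositions_def PiE_def extensional_def)
    ultimately show "(k i, k(i := undefined)) \<in> Sigma {..n} (\<lambda>j. compositions I (n - j))"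
      using assms by (auto simp: compositions_def intro!: sum.cong)
  next
    fix a assume a: "a \<in> Sigma {..n} (\<lambda>j. compositions I (n - j))"
    then obtain j k where jk: "a = (j, k)" "j \<le> n" "k \<in> compositions I (n - j)" by auto
    then have "k i = undefined" using assms by (auto simp: compositions_def PiE_def extensional_def)
    then show "(\<lambda>k. (k i, k(i := undefined))) ((\<lambda>(j, k). k(i := j)) a) = a" using jk by auto
    show "(\<lambda>(j, k). k(i := j)) a \<in> compositions (insert i I) n"
      using jk assms by (auto simp: compositions_def PiE_def extensional_def s fun_upd_same simp del: fun_upd_apply)
         (simp add: fun_upd_def)
  qed auto
  also have "\<dots> = (\<Sum>j\<le>n. \<Sum>k\<in>compositions I (n - j). F (k(i := j)))"
    using assms by (subst sum.Sigma) auto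
  finally show ?thesis .
qed

lemma multinomial_theorem_compositions:
  fixes w :: "'i \<Rightarrow> real"
  assumes "finite I"
  shows "(\<Sum>k\<in>compositions I n. \<Prod>i\<in>I. w i ^ k i / fact (k i)) = (\<Sum>i\<in>I. w i) ^ n / fact n"
  using assms
proof (induction I arbitrary: n rule: finite_induct)
  case empty
  then show ?case by (simp add: compositions_empty)
next
  case (insert i I)
  have p: "(\<Prod>l\<in>I. w l ^ (k(i := j)) l / fact ((k(i := j)) l)) = (\<Prod>l\<in>I. w l ^ k l / fact (k l))" for k :: "'i \<Rightarrow> nat" and j
    using insert by (intro prod.cong) auto
  have "(\<Sum>k\<in>compositions (insert i I) n. \<Prod>l\<in>insert i I. w l ^ k l / fact (k l))
     = (\<Sum>j\<le>n. \<Sum>k\<in>compositions I (n - j). w i ^ j / fact j * (\<Prod>l\<in>I. w l ^ k l / fact (k l)))"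
    using insert by (simp add: sum_compositions_insert p fun_upd_same del: fun_upd_apply)
  also have "\<dots> = (\<Sum>j\<le>n. w i ^ j / fact j * ((\<Sum>l\<in>I. w l) ^ (n - j) / fact (n - j)))"
    using insert.IH by (simp only: sum_distrib_left[symmetric])
  also have "\<dots> = (\<Sum>j\<le>n. real (n choose j) * w i ^ j * (\<Sum>l\<in>I. w l) ^ (n - j)) / fact n"
    unfolding sum_divide_distrib by (intro sum.cong refl) (simp add: binomial_fact)
  also have "\<dots> = (w i + (\<Sum>l\<in>I. w l)) ^ n / fact n" by (simp add: binomial_ring)
  finally show ?case using insert by simp
qed

definition multinomial_mass :: "'i set \<Rightarrow> nat \<Rightarrow> ('i \<Rightarrow> real) \<Rightarrow> ('i \<Rightarrow> nat) \<Rightarrow> real" where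
  "multinomial_mass I n w k = fact n * (\<Prod>i\<in>I. w i ^ k i / fact (k i))"

text \<open>
  Once the cell \<open>i\<close> is split off, the multinomial theorem sums over the remaining cells, whose total
  probability is $1 - w_i$.
\<close>

lemma multinomial_marginal:
  fixes w :: "'i \<Rightarrow> real"
  assumes fin: "finite I" and i: "i \<in> I" and w: "(\<Sum>i\<in>I. w i) = 1"
  shows "(\<Sum>k\<in>compositions I n. multinomial_mass I n w k * h (k i)) = (\<Sum>j\<le>n. Bernstein n j (w i) * h j)"
proof -
  define J where "J = I - {i}"
  have J: "finite J" "i \<notin> J" "I = insert i J" using fin i by (auto simp: J_def)
  have p: "(\<Prod>l\<in>J. w l ^ (k(i := j)) l / fact ((k(i := j)) l)) = (\<Prod>l\<in>J. w l ^ k l / fact (k l))" for k :: "'i \<Rightarrow> nat" and j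
    using J by (intro prod.cong) auto
  have wJ: "(\<Sum>l\<in>J. w l) = 1 - w i" using w J by simp
  have "(\<Sum>k\<in>compositions I n. multinomial_mass I n w k * h (k i))
     = (\<Sum>j\<le>n. \<Sum>k\<in>compositions J (n - j). (fact n * (w i ^ j / fact j) * h j) * (\<Prod>l\<in>J. w l ^ k l / fact (k l)))"
    using J by (simp add: multinomial_mass_def sum_compositions_insert p fun_upd_same mult_ac del: fun_upd_apply)
  also have "\<dots> = (\<Sum>j\<le>n. (fact n * (w i ^ j / fact j) * h j) * ((1 - w i) ^ (n - j) / fact (n - j)))"
    by (simp only: sum_distrib_left[symmetric] multinomial_theorem_compositions[OF J(1)] wJ)
  also have "\<dots> = (\<Sum>j\<le>n. Bernstein n j (w i) * h j)"
    by (intro sum.cong refl) (simp add: Bernstein_def binomial_fact)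
  finally show ?thesis .
qed

text \<open>
  The leftover count \<open>N - (\<Sum>i<d. k i)\<close> and its probability are appended as the coordinate \<open>d\<close>, which
  makes the roles of all cells symmetric.
\<close>

definition all_counts :: "nat \<Rightarrow> nat \<Rightarrow> (nat \<Rightarrow> nat) \<Rightarrow> nat \<Rightarrow> nat" where
  "all_counts d N k = k(d := N - (\<Sum>i<d. k i))"

definition all_probs :: "nat \<Rightarrow> (nat \<Rightarrow> real) \<Rightarrow> nat \<Rightarrow> real" where
  "all_probs d p = p(d := 1 - l1_norm d p)"

lemma bij_betw_all_counts:
  "bij_betw (all_counts d N) (multinomial_grid d N) (compositions {..<Suc d} N)"
proof (rule bij_betw_byWitness[where f' = "\<lambda>k. k(d := undefined)"])
  show "\<forall>k\<in>multinomial_grid d N. (all_counts d N k)(d := undefined) = k"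
    by (auto simp: all_counts_def multinomial_grid_def PiE_def extensional_def)
  have c: "(\<Sum>i<d. k i) + k d = N" if "k \<in> compositions {..<Suc d} N" for k
    using that by (simp add: compositions_def)
  show "\<forall>k\<in>compositions {..<Suc d} N. all_counts d N (k(d := undefined)) = k"
    using c by (fastforce simp: all_counts_def fun_eq_iff)
  show "all_counts d N ` multinomial_grid d N \<subseteq> compositions {..<Suc d} N"
    by (auto simp: all_counts_def multinomial_grid_def compositions_def PiE_def extensional_def)
  show "(\<lambda>k. k(d := undefined)) ` compositions {..<Suc d} N \<subseteq> multinomial_grid d N"
    using c by (force simp: multinomial_grid_def compositions_def PiE_def extensional_def)
qed

lemma finite_multinomial_grid [simp]: "finite (multinomial_grid d N)"
  using bij_betw_finite[OF bij_betw_all_counts[of d N]] by simp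

lemma multinomial_grid_mass:
  assumes "k \<in> multinomial_grid d N"
  shows "fact N / (fact (N - (\<Sum>i<d. k i)) * (\<Prod>i<d. fact (k i)))
       * (1 - l1_norm d p) ^ (N - (\<Sum>i<d. k i)) * (\<Prod>i<d. p i ^ k i)
     = multinomial_mass {..<Suc d} N (all_probs d p) (all_counts d N k)"
  by (simp add: multinomial_mass_def all_counts_def all_probs_def prod_dividef mult_ac)

lemma sum_multinomial_grid_marginal:
  assumes i: "i < Suc d" and p: "(\<Sum>i<Suc d. all_probs d p i) = 1"
  shows "(\<Sum>k\<in>multinomial_grid d N. multinomial_mass {..<Suc d} N (all_probs d p) (all_counts d N k) * h (all_counts d N k i))
    = (\<Sum>j\<le>N. Bernstein N j (all_probs d p i) * h j)"
  using multinomial_marginal[of "{..<Suc d}" i "all_probs d p" N h] i p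
    sum.reindex_bij_betw[OF bij_betw_all_counts[of d N], of "\<lambda>k. multinomial_mass {..<Suc d} N (all_probs d p) k * h (k i)"]
  by simp

section \<open>Determinant and inverse of the multinomial covariance matrix\<close>

lemma four_block_mat_cong:
  assumes "A = A'" "B = B'" "C = C'" "D = D'"
  shows "four_block_mat A B C D = four_block_mat A' B' C' D'"
  using assms by simp

text \<open>
  The matrix determinant lemma: the block matrix with diagonal block \<open>diag p\<close>, border \<open>p\<close> and corner
  1 is factored in two ways, with the Schur complement of either diagonal block.
\<close>

lemma det_multinomial_cov:
  fixes p :: "nat \<Rightarrow> real"
  shows "Determinant.det (multinomial_cov d p) = (\<Prod>i<d. p i) * (1 - (\<Sum>i<d. p i))"
proof -
  let ?c = "multinomial_cov d p"
  let ?u = "Matrix.mat d 1 (\<lambda>(i, j). p i)"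
  let ?v = "Matrix.mat 1 d (\<lambda>(i, j). p j)"
  let ?e = "Matrix.mat 1 d (\<lambda>(i, j). 1 :: real)"
  let ?q = "Matrix.mat 1 1 (\<lambda>(i, j). 1 - (\<Sum>i<d. p i))"
  let ?D = "mat_diag d p"
  let ?M = "four_block_mat ?D ?u ?v (1\<^sub>m 1)"
  have c: "?c \<in> carrier_mat d d" unfolding multinomial_cov_def by (intro minus_carrier_mat) simp
  \<comment> \<open>Eliminating the border with the corner 1 leaves \<open>?c\<close>.\<close>
  have "four_block_mat (1\<^sub>m d) ?u (0\<^sub>m 1 d) (1\<^sub>m 1) * four_block_mat ?c (0\<^sub>m d 1) ?v (1\<^sub>m 1)
     = four_block_mat (1\<^sub>m d * ?c + ?u * ?v) (1\<^sub>m d * 0\<^sub>m d 1 + ?u * 1\<^sub>m 1)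
         (0\<^sub>m 1 d * ?c + 1\<^sub>m 1 * ?v) (0\<^sub>m 1 d * 0\<^sub>m d 1 + 1\<^sub>m 1 * 1\<^sub>m 1)"
    using c by (intro mult_four_block_mat[where ?nr1.0 = d and ?n1.0 = d and ?n2.0 = 1 and ?nr2.0 = 1 and ?nc1.0 = d and ?nc2.0 = 1]) auto
  also have "\<dots> = ?M"
  proof (rule four_block_mat_cong)
    show "1\<^sub>m d * ?c + ?u * ?v = ?D"
      unfolding left_mult_one_mat[OF c]
      by (intro eq_matI) (auto simp: multinomial_cov_def mat_diag_def scalar_prod_def)
    show "0\<^sub>m 1 d * ?c + 1\<^sub>m 1 * ?v = ?v" using c by simp
  qed auto
  finally have eq1: "four_block_mat (1\<^sub>m d) ?u (0\<^sub>m 1 d) (1\<^sub>m 1) * four_block_mat ?c (0\<^sub>m d 1) ?v (1\<^sub>m 1) = ?M" .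
  have 1: "Determinant.det ?M = Determinant.det ?c"
  proof -
    have "Determinant.det (four_block_mat (1\<^sub>m d) ?u (0\<^sub>m 1 d) (1\<^sub>m 1) * four_block_mat ?c (0\<^sub>m d 1) ?v (1\<^sub>m 1))
      = Determinant.det (four_block_mat (1\<^sub>m d) ?u (0\<^sub>m 1 d) (1\<^sub>m 1)) * Determinant.det (four_block_mat ?c (0\<^sub>m d 1) ?v (1\<^sub>m 1))"
      using c by (intro det_mult[where n = "d + 1"]; intro four_block_carrier_mat) simp_all
    also have "Determinant.det (four_block_mat (1\<^sub>m d) ?u (0\<^sub>m 1 d) (1\<^sub>m 1)) = Determinant.det (1\<^sub>m d) * Determinant.det (1\<^sub>m 1)"
      by (rule det_four_block_mat_lower_left_zero) auto
    also have "Determinant.det (four_block_mat ?c (0\<^sub>m d 1) ?v (1\<^sub>m 1)) = Determinant.det ?c * Determinant.det (1\<^sub>m 1)"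
      by (rule det_four_block_mat_upper_right_zero) (use c in auto)
    finally show ?thesis unfolding eq1 by simp
  qed
  \<comment> \<open>Eliminating it with \<open>?D\<close> leaves \<open>?q\<close> in the corner.\<close>
  have "four_block_mat (1\<^sub>m d) (0\<^sub>m d 1) ?e (1\<^sub>m 1) * four_block_mat ?D ?u (0\<^sub>m 1 d) ?q
     = four_block_mat (1\<^sub>m d * ?D + 0\<^sub>m d 1 * 0\<^sub>m 1 d) (1\<^sub>m d * ?u + 0\<^sub>m d 1 * ?q)
         (?e * ?D + 1\<^sub>m 1 * 0\<^sub>m 1 d) (?e * ?u + 1\<^sub>m 1 * ?q)"
    by (intro mult_four_block_mat[where ?nr1.0 = d and ?n1.0 = d and ?n2.0 = 1 and ?nr2.0 = 1 and ?nc1.0 = d and ?nc2.0 = 1]) auto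
  also have "\<dots> = ?M"
  proof (rule four_block_mat_cong)
    show "1\<^sub>m d * ?D + 0\<^sub>m d 1 * 0\<^sub>m 1 d = ?D" by (simp add: left_mult_one_mat[OF mat_diag_dim])
    show "1\<^sub>m d * ?u + 0\<^sub>m d 1 * ?q = ?u" by simp
    show "?e * ?D + 1\<^sub>m 1 * 0\<^sub>m 1 d = ?v"
      by (subst mat_diag_mult_right[where nr = 1]) (auto intro!: eq_matI)
    show "?e * ?u + 1\<^sub>m 1 * ?q = 1\<^sub>m 1"
      by (intro eq_matI) (auto simp: scalar_prod_def lessThan_atLeast0)
  qed
  finally have eq2: "four_block_mat (1\<^sub>m d) (0\<^sub>m d 1) ?e (1\<^sub>m 1) * four_block_mat ?D ?u (0\<^sub>m 1 d) ?q = ?M" .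
  have "Determinant.det ?M = Determinant.det ?D * (1 - (\<Sum>i<d. p i))"
  proof -
    have "Determinant.det (four_block_mat (1\<^sub>m d) (0\<^sub>m d 1) ?e (1\<^sub>m 1) * four_block_mat ?D ?u (0\<^sub>m 1 d) ?q)
      = Determinant.det (four_block_mat (1\<^sub>m d) (0\<^sub>m d 1) ?e (1\<^sub>m 1)) * Determinant.det (four_block_mat ?D ?u (0\<^sub>m 1 d) ?q)"
      by (intro det_mult[where n = "d + 1"]; intro four_block_carrier_mat) simp_all
    also have "Determinant.det (four_block_mat (1\<^sub>m d) (0\<^sub>m d 1) ?e (1\<^sub>m 1)) = Determinant.det (1\<^sub>m d) * Determinant.det (1\<^sub>m 1)"
      by (rule det_four_block_mat_upper_right_zero) auto
    also have "Determinant.det (four_block_mat ?D ?u (0\<^sub>m 1 d) ?q) = Determinant.det ?D * Determinant.det ?q"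
      by (rule det_four_block_mat_lower_left_zero) auto
    also have "Determinant.det ?q = 1 - (\<Sum>i<d. p i)"
      by (subst det_upper_triangular[where n = 1]) (auto simp: diag_mat_def)
    finally show ?thesis unfolding eq2 by simp
  qed
  also have "Determinant.det ?D = (\<Prod>i<d. p i)"
    by (subst det_upper_triangular[where n = d])
      (auto simp: mat_diag_def prod_list_diag_prod lessThan_atLeast0)
  finally show ?thesis using 1 by simp
qed

lemma mat_inverse_eqI:
  fixes A B :: "'a :: field mat"
  assumes A: "A \<in> carrier_mat n n" and B: "B \<in> carrier_mat n n" and AB: "A * B = 1\<^sub>m n"
  shows "the (mat_inverse A) = B"
proof -
  have BA: "B * A = 1\<^sub>m n" using mat_mult_left_right_inverse[OF A B AB] .
  have "A \<in> Units (ring_mat TYPE('a) n ())"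
    using A B AB BA by (auto simp: Units_def ring_mat_simps)
  then obtain C where C: "mat_inverse A = Some C" using mat_inverse(1)[OF A, of "()"] by (cases "mat_inverse A") auto
  have "C * A = 1\<^sub>m n" "C \<in> carrier_mat n n" using mat_inverse(2)[OF A C] by auto
  then have "C = C * (A * B)" using AB by simp
  also have "\<dots> = B" using \<open>C * A = 1\<^sub>m n\<close> \<open>C \<in> carrier_mat n n\<close> A B
    by (subst assoc_mult_mat[symmetric]) auto
  finally show ?thesis using C by simp
qed

lemma multinomial_precision_matrix:
  fixes p :: "nat \<Rightarrow> real" and c :: real
  assumes p: "\<And>i. i < d \<Longrightarrow> p i > 0" and q: "(\<Sum>i<d. p i) < 1" and c: "c > 0"
  shows "the (mat_inverse (c \<cdot>\<^sub>m multinomial_cov d p)) =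
    Matrix.mat d d (\<lambda>(i, j). (if i = j then 1 / (c * p i) else 0) + 1 / (c * (1 - (\<Sum>i<d. p i))))"
proof (rule mat_inverse_eqI[where n = d])
  define q where "q = 1 - (\<Sum>i<d. p i)"
  have q0: "q > 0" using q by (simp add: q_def)
  let ?B = "Matrix.mat d d (\<lambda>(i, j). (if i = j then 1 / (c * p i) else 0) + 1 / (c * (1 - (\<Sum>i<d. p i))))"
  show "c \<cdot>\<^sub>m multinomial_cov d p * ?B = 1\<^sub>m d"
  proof (rule eq_matI)
    fix i j assume "i < dim_row (1\<^sub>m d)" "j < dim_col (1\<^sub>m d)"
    then have ij: "i < d" "j < d" by auto
    have "(c \<cdot>\<^sub>m multinomial_cov d p * ?B) $$ (i, j)
       = (\<Sum>k<d. c * ((if i = k then p k else 0) - p i * p k) * ((if k = j then 1 / (c * p k) else 0) + 1 / (c * q)))"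
      using ij by (simp add: multinomial_cov_def mat_diag_def scalar_prod_def q_def lessThan_atLeast0)
    also have "\<dots> = (\<Sum>k<d. (if k = i then (if i = j then 1 else 0) + p i / q else 0)
        - (if k = j then p i else 0) - p i / q * p k)"
    proof (rule sum.cong[OF refl])
      fix k assume "k \<in> {..<d}"
      then have "p k > 0" using p by simp
      then show "c * ((if i = k then p k else 0) - p i * p k) * ((if k = j then 1 / (c * p k) else 0) + 1 / (c * q))
        = (if k = i then (if i = j then 1 else 0) + p i / q else 0) - (if k = j then p i else 0) - p i / q * p k"
        using c q0 by (auto simp: field_simps)
    qed
    also have "\<dots> = (if i = j then 1 else 0) + p i / q - p i - p i / q * (1 - q)"
      using ij by (simp only: sum_subtractf sum_distrib_left[symmetric]) (simp add: q_def)
    also have "\<dots> = (if i = j then 1 else 0)" using q0 by (simp add: field_simps)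
    finally show "(c \<cdot>\<^sub>m multinomial_cov d p * ?B) $$ (i, j) = 1\<^sub>m d $$ (i, j)" using ij by simp
  qed (auto simp: multinomial_cov_def mat_diag_def)
qed (auto simp: multinomial_cov_def mat_diag_def)

text \<open>
  The quadratic form of the inverse of a multinomial covariance matrix, for expected counts \<open>a\<close> in
  the first \<open>d\<close> cells and \<open>c\<close> in the last one.
\<close>

definition cell_form :: "nat \<Rightarrow> (nat \<Rightarrow> real) \<Rightarrow> real \<Rightarrow> (nat \<Rightarrow> real) \<Rightarrow> real" where
  "cell_form d a c v = (\<Sum>i<d. (v i)\<^sup>2 / a i) + (\<Sum>i<d. v i)\<^sup>2 / c"

lemma precision_quadratic_form:
  fixes v a :: "nat \<Rightarrow> real" and c :: real and d :: nat
  defines "B \<equiv> Matrix.mat d d (\<lambda>(i, j). (if i = j then 1 / a i else 0) + 1 / c)"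
  shows "scalar_prod (Matrix.vec d v) (B *\<^sub>v Matrix.vec d v) = cell_form d a c v"
proof -
  have "scalar_prod (Matrix.vec d v) (B *\<^sub>v Matrix.vec d v)
     = (\<Sum>i<d. v i * (\<Sum>j<d. ((if i = j then 1 / a i else 0) + 1 / c) * v j))"
    by (simp add: B_def scalar_prod_def lessThan_atLeast0)
  also have "\<dots> = (\<Sum>i<d. (v i)\<^sup>2 / a i + v i * ((\<Sum>j<d. v j) / c))"
  proof (rule sum.cong[OF refl])
    fix i assume i: "i \<in> {..<d}"
    have "(\<Sum>j<d. ((if i = j then 1 / a i else 0) + 1 / c) * v j)
      = (\<Sum>j<d. (if j = i then v i / a i else 0) + v j / c)"
      by (intro sum.cong refl) (auto simp: algebra_simps)
    also have "\<dots> = v i / a i + (\<Sum>j<d. v j) / c" using i by (simp add: sum.distrib sum_divide_distrib)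
    finally show "v i * (\<Sum>j<d. ((if i = j then 1 / a i else 0) + 1 / c) * v j) = (v i)\<^sup>2 / a i + v i * ((\<Sum>j<d. v j) / c)"
      by (simp add: algebra_simps power2_eq_square)
  qed
  also have "\<dots> = cell_form d a c v"
    unfolding sum.distrib sum_distrib_right[symmetric] by (simp add: cell_form_def power2_eq_square)
  finally show ?thesis .
qed

lemma normal_measure_multinomial:
  fixes p :: "nat \<Rightarrow> real"
  assumes p: "\<And>i. i < d \<Longrightarrow> p i > 0" and q: "(\<Sum>i<d. p i) < 1" and N: "N > 0"
  shows "normal_measure d \<mu> (N \<cdot>\<^sub>m multinomial_cov d p) = density (Pi\<^sub>M {..<d} (\<lambda>_. lborel))
    (\<lambda>x. ennreal (exp (- cell_form d (\<lambda>i. N * p i) (N * (1 - (\<Sum>i<d. p i))) (\<lambda>i. x i - \<mu> i) / 2)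
       / sqrt ((2 * pi) ^ d * (N ^ d * ((\<Prod>i<d. p i) * (1 - (\<Sum>i<d. p i)))))))"
proof -
  have "dim_col (multinomial_cov d p) = d" by (simp add: multinomial_cov_def mat_diag_def)
  then have "Determinant.det (N \<cdot>\<^sub>m multinomial_cov d p) = N ^ d * ((\<Prod>i<d. p i) * (1 - (\<Sum>i<d. p i)))"
    by (simp add: det_multinomial_cov)
  then show ?thesis
    by (simp only: normal_measure_def Let_def multinomial_precision_matrix[OF p q N] precision_quadratic_form)
qed

section \<open>Normalisation of the Gaussian density\<close>

lemma exp_half_mult: "exp (- A / 2) * exp (- B / 2) = exp (- (A + B) / 2)" for A B :: real
  by (simp add: exp_add[symmetric] add_divide_distrib)

text \<open>
  Completing the square in \<open>y\<close>. Up to constants this is the convolution of two centred normal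
  densities with variances \<open>a\<close> and \<open>c\<close>.
\<close>

lemma nn_integral_gaussian_convolution:
  fixes a c s m :: real
  assumes a: "a > 0" and c: "c > 0"
  shows "(\<integral>\<^sup>+ y. ennreal (exp (- ((y - m)\<^sup>2 / a + (s + (y - m))\<^sup>2 / c) / 2)) \<partial>lborel)
    = ennreal (sqrt (2 * pi * (a * c / (a + c))) * exp (- (s\<^sup>2 / (a + c)) / 2))"
proof -
  define \<sigma> where "\<sigma> = sqrt (a * c / (a + c))"
  define \<mu> where "\<mu> = m - s * a / (a + c)"
  have \<sigma>: "\<sigma> > 0" "\<sigma>\<^sup>2 = a * c / (a + c)" using a c by (auto simp: \<sigma>_def)
  have quad: "(y - m)\<^sup>2 / a + (s + (y - m))\<^sup>2 / c = (y - \<mu>)\<^sup>2 / \<sigma>\<^sup>2 + s\<^sup>2 / (a + c)" for y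
  proof -
    define z where "z = y - m"
    have "y - \<mu> = z + s * a / (a + c)" by (simp add: z_def \<mu>_def)
    moreover have "(a + c) * (z\<^sup>2 * c + (s + z)\<^sup>2 * a) = (z * (a + c) + s * a)\<^sup>2 + s\<^sup>2 * a * c"
      by (simp add: power2_eq_square algebra_simps)
    then have "z\<^sup>2 / a + (s + z)\<^sup>2 / c = (z + s * a / (a + c))\<^sup>2 / (a * c / (a + c)) + s\<^sup>2 / (a + c)"
      using a c by (simp add: divide_simps add_pos_pos) (simp add: power2_eq_square algebra_simps)
    ultimately show ?thesis unfolding \<sigma>(2) z_def[symmetric] by simp
  qed
  let ?C = "sqrt (2 * pi * (a * c / (a + c))) * exp (- (s\<^sup>2 / (a + c)) / 2)"
  have eq: "exp (- ((y - m)\<^sup>2 / a + (s + (y - m))\<^sup>2 / c) / 2) = ?C * normal_density \<mu> \<sigma> y" for y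
  proof -
    have "sqrt (2 * pi * \<sigma>\<^sup>2) \<noteq> 0" using \<sigma>(1) by simp
    then have "sqrt (2 * pi * \<sigma>\<^sup>2) * normal_density \<mu> \<sigma> y = exp (- (y - \<mu>)\<^sup>2 / (2 * \<sigma>\<^sup>2))"
      unfolding normal_density_def by simp
    then have "?C * normal_density \<mu> \<sigma> y = exp (- (s\<^sup>2 / (a + c)) / 2) * exp (- (y - \<mu>)\<^sup>2 / (2 * \<sigma>\<^sup>2))"
      unfolding \<sigma>(2)[symmetric] by (simp add: mult_ac)
    moreover have "- (y - \<mu>)\<^sup>2 / (2 * \<sigma>\<^sup>2) = - ((y - \<mu>)\<^sup>2 / \<sigma>\<^sup>2) / 2" by simp
    ultimately show ?thesis unfolding quad by (simp only: exp_half_mult add.commute)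
  qed
  have "(\<integral>\<^sup>+ y. ennreal (normal_density \<mu> \<sigma> y) \<partial>lborel) = 1"
    using \<sigma>(1) by (subst nn_integral_eq_integral) (auto simp: integrable_normal_density integral_normal_density)
  then show ?thesis unfolding eq using a c
    by (subst ennreal_mult) (auto simp: nn_integral_cmult)
qed

interpretation lborel_product: product_sigma_finite "\<lambda>_. lborel"
  by standard

text \<open>
  Integrating out one coordinate turns the variance \<open>c\<close> into \<open>a d + c\<close> and leaves an integral of the
  same shape. The offset \<open>s\<close> is what makes the induction work: it stands for the coordinates that
  are still to be integrated.
\<close>

lemma nn_integral_cell_form_shifted:
  fixes a \<mu> :: "nat \<Rightarrow> real" and c s :: real
  assumes a: "\<And>i. i < d \<Longrightarrow> a i > 0" and c: "c > 0"
  shows "(\<integral>\<^sup>+ x. ennreal (exp (- ((\<Sum>i<d. (x i - \<mu> i)\<^sup>2 / a i) + (s + (\<Sum>i<d. x i - \<mu> i))\<^sup>2 / c) / 2))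
        \<partial>(Pi\<^sub>M {..<d} (\<lambda>_. lborel)))
    = ennreal (sqrt ((2 * pi) ^ d * (\<Prod>i<d. a i) * (c / (c + (\<Sum>i<d. a i)))) * exp (- (s\<^sup>2 / (c + (\<Sum>i<d. a i))) / 2))"
  using assms
proof (induction d arbitrary: c)
  case 0
  then show ?case by (simp add: PiM_empty nn_integral_count_space_finite)
next
  case (Suc d)
  have ad: "a d > 0" and a: "\<And>i. i < d \<Longrightarrow> a i > 0" using Suc.prems by auto
  have ins: "{..<Suc d} = insert d {..<d}" by auto
  let ?Q = "\<lambda>x. \<Sum>i<d. (x i - \<mu> i)\<^sup>2 / a i" and ?S = "\<lambda>x. s + (\<Sum>i<d. x i - \<mu> i)"
  let ?C = "sqrt (2 * pi * (a d * c / (a d + c)))"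
  have inner: "(\<integral>\<^sup>+ y. ennreal (exp (- (?Q x + ((y - \<mu> d)\<^sup>2 / a d + (?S x + (y - \<mu> d))\<^sup>2 / c)) / 2)) \<partial>lborel)
     = ennreal ?C * ennreal (exp (- (?Q x + (?S x)\<^sup>2 / (a d + c)) / 2))" for x
  proof -
    have "exp (- (?Q x + ((y - \<mu> d)\<^sup>2 / a d + (?S x + (y - \<mu> d))\<^sup>2 / c)) / 2)
      = exp (- ?Q x / 2) * exp (- ((y - \<mu> d)\<^sup>2 / a d + (?S x + (y - \<mu> d))\<^sup>2 / c) / 2)" for y
      by (simp only: exp_half_mult)
    then have "(\<integral>\<^sup>+ y. ennreal (exp (- (?Q x + ((y - \<mu> d)\<^sup>2 / a d + (?S x + (y - \<mu> d))\<^sup>2 / c)) / 2)) \<partial>lborel)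
      = ennreal (exp (- ?Q x / 2)) * (\<integral>\<^sup>+ y. ennreal (exp (- ((y - \<mu> d)\<^sup>2 / a d + (?S x + (y - \<mu> d))\<^sup>2 / c) / 2)) \<partial>lborel)"
      by (simp only: ennreal_mult exp_ge_zero) (rule nn_integral_cmult, measurable)
    also have "\<dots> = ennreal (exp (- ?Q x / 2) * (?C * exp (- ((?S x)\<^sup>2 / (a d + c)) / 2)))"
      unfolding nn_integral_gaussian_convolution[OF ad \<open>c > 0\<close>] using ad \<open>c > 0\<close> by (subst ennreal_mult) auto
    also have "exp (- ?Q x / 2) * (?C * exp (- ((?S x)\<^sup>2 / (a d + c)) / 2))
      = ?C * (exp (- ?Q x / 2) * exp (- ((?S x)\<^sup>2 / (a d + c)) / 2))" by (simp only: mult_ac)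
    also have "exp (- ?Q x / 2) * exp (- ((?S x)\<^sup>2 / (a d + c)) / 2) = exp (- (?Q x + (?S x)\<^sup>2 / (a d + c)) / 2)"
      by (simp only: exp_half_mult)
    finally show ?thesis using ad \<open>c > 0\<close> by (simp add: ennreal_mult)
  qed
  have "(\<integral>\<^sup>+ x. ennreal (exp (- ((\<Sum>i<Suc d. (x i - \<mu> i)\<^sup>2 / a i) + (s + (\<Sum>i<Suc d. x i - \<mu> i))\<^sup>2 / c) / 2))
        \<partial>(Pi\<^sub>M {..<Suc d} (\<lambda>_. lborel)))
     = (\<integral>\<^sup>+ x. (\<integral>\<^sup>+ y. ennreal (exp (- (?Q x + ((y - \<mu> d)\<^sup>2 / a d + (?S x + (y - \<mu> d))\<^sup>2 / c)) / 2)) \<partial>lborel)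
        \<partial>(Pi\<^sub>M {..<d} (\<lambda>_. lborel)))"
    unfolding ins by (subst lborel_product.product_nn_integral_insert) (auto simp: add_ac)
  also have "\<dots> = ennreal ?C * (\<integral>\<^sup>+ x. ennreal (exp (- (?Q x + (?S x)\<^sup>2 / (a d + c)) / 2)) \<partial>(Pi\<^sub>M {..<d} (\<lambda>_. lborel)))"
    unfolding inner by (rule nn_integral_cmult) measurable
  also have "\<dots> = ennreal ?C * ennreal (sqrt ((2 * pi) ^ d * (\<Prod>i<d. a i) * ((a d + c) / ((a d + c) + (\<Sum>i<d. a i))))
      * exp (- (s\<^sup>2 / ((a d + c) + (\<Sum>i<d. a i))) / 2))"
    using Suc.IH[OF a, of "a d + c"] ad \<open>c > 0\<close> by simp
  also have "\<dots> = ennreal (?C * sqrt ((2 * pi) ^ d * (\<Prod>i<d. a i) * ((a d + c) / ((a d + c) + (\<Sum>i<d. a i))))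
      * exp (- (s\<^sup>2 / ((a d + c) + (\<Sum>i<d. a i))) / 2))"
    using ad \<open>c > 0\<close> by (subst ennreal_mult'[symmetric]) (auto simp: mult_ac)
  also have "?C * sqrt ((2 * pi) ^ d * (\<Prod>i<d. a i) * ((a d + c) / ((a d + c) + (\<Sum>i<d. a i))))
      = sqrt ((2 * pi) ^ Suc d * (\<Prod>i<Suc d. a i) * (c / (c + (\<Sum>i<Suc d. a i))))"
    unfolding real_sqrt_mult[symmetric] using ad \<open>c > 0\<close> by (simp add: mult_ac add_ac)
  finally show ?case by (simp add: add_ac)
qed

lemma nn_integral_gaussian_cell_form:
  fixes a \<mu> :: "nat \<Rightarrow> real" and c :: real
  assumes a: "\<And>i. i < d \<Longrightarrow> a i > 0" and c: "c > 0"
  shows "(\<integral>\<^sup>+ x. ennreal (exp (- cell_form d a c (\<lambda>i. x i - \<mu> i) / 2)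
       / sqrt ((2 * pi) ^ d * ((\<Prod>i<d. a i) * (c / (c + (\<Sum>i<d. a i)))))) \<partial>(Pi\<^sub>M {..<d} (\<lambda>_. lborel))) = 1"
proof -
  define Z where "Z = sqrt ((2 * pi) ^ d * ((\<Prod>i<d. a i) * (c / (c + (\<Sum>i<d. a i)))))"
  have "(\<Prod>i<d. a i) > 0" using a by (auto intro!: prod_pos)
  moreover have "(\<Sum>i<d. a i) \<ge> 0" using a by (intro sum_nonneg) (simp add: less_imp_le)
  ultimately have Z: "Z > 0" using c by (simp add: Z_def)
  have "(\<integral>\<^sup>+ x. ennreal (exp (- cell_form d a c (\<lambda>i. x i - \<mu> i) / 2) / Z) \<partial>(Pi\<^sub>M {..<d} (\<lambda>_. lborel)))
     = (\<integral>\<^sup>+ x. ennreal (1 / Z) * ennreal (exp (- cell_form d a c (\<lambda>i. x i - \<mu> i) / 2)) \<partial>(Pi\<^sub>M {..<d} (\<lambda>_. lborel)))"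
    using Z by (intro nn_integral_cong) (simp add: ennreal_mult[symmetric])
  also have "\<dots> = ennreal (1 / Z) * (\<integral>\<^sup>+ x. ennreal (exp (- cell_form d a c (\<lambda>i. x i - \<mu> i) / 2)) \<partial>(Pi\<^sub>M {..<d} (\<lambda>_. lborel)))"
    unfolding cell_form_def by (rule nn_integral_cmult) measurable
  also have "\<dots> = ennreal (1 / Z) * ennreal Z"
    using nn_integral_cell_form_shifted[where d = d and a = a and c = c and s = 0 and \<mu> = \<mu>] a c
    by (simp add: cell_form_def Z_def mult.assoc)
  also have "\<dots> = 1" using Z by (simp add: ennreal_mult[symmetric])
  finally show ?thesis unfolding Z_def .
qed

section \<open>Total variation and relative entropy\<close>

text \<open>
  The pointwise form of Pinsker's inequality with a free parameter. The distance factors as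
  $|\sqrt f - \sqrt g| (\sqrt f + \sqrt g)$; the weighted inequality between arithmetic and geometric
  mean separates the factors, and $\ln x \le x - 1$ at $x = \sqrt{g/f}$ bounds the first one.
\<close>

lemma abs_diff_le_entropy:
  fixes f g a :: real
  assumes f: "f \<ge> 0" and g: "g > 0" and a: "a > 0"
  shows "\<bar>f - g\<bar> \<le> a * (f * ln f - f * ln g - f + g) + (f + g) / (2 * a)"
proof -
  define u where "u = sqrt f"
  define v where "v = sqrt g"
  have uv: "u \<ge> 0" "v > 0" "f = u\<^sup>2" "g = v\<^sup>2" using f g by (auto simp: u_def v_def)
  \<comment> \<open>Squared Hellinger distance is at most relative entropy.\<close>
  have ent: "(u - v)\<^sup>2 \<le> f * ln f - f * ln g - f + g"
  proof (cases "u = 0")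
    case False
    then have u: "u > 0" using uv by simp
    have "ln (v / u) \<le> v / u - 1" using u uv by (intro ln_le_minus_one) auto
    then have "2 * u\<^sup>2 * ln (v / u) \<le> 2 * u\<^sup>2 * (v / u - 1)" by (intro mult_left_mono) auto
    also have "\<dots> = 2 * u * v - 2 * u\<^sup>2" using u by (simp add: field_simps power2_eq_square)
    finally have "2 * u\<^sup>2 * (ln v - ln u) \<le> 2 * u * v - 2 * u\<^sup>2" using u uv by (simp add: ln_div)
    moreover have "ln f = 2 * ln u" "ln g = 2 * ln v" using u uv by (auto simp: ln_realpow)
    ultimately show ?thesis using uv(3,4) by (simp add: power2_eq_square algebra_simps)
  qed (use uv in auto)
  have "\<bar>f - g\<bar> = \<bar>u - v\<bar> * (u + v)"
    using uv by (simp add: power2_eq_square square_diff_square_factored abs_mult)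
  also have "\<dots> \<le> a * (u - v)\<^sup>2 + (u + v)\<^sup>2 / (4 * a)"
  proof -
    have "0 \<le> (2 * a * \<bar>u - v\<bar> - (u + v))\<^sup>2 / (4 * a)" using a by simp
    also have "\<dots> = a * \<bar>u - v\<bar>\<^sup>2 + (u + v)\<^sup>2 / (4 * a) - \<bar>u - v\<bar> * (u + v)"
      using a by (simp add: field_simps power2_eq_square del: abs_mult_self_eq)
    finally show ?thesis by simp
  qed
  also have "\<dots> \<le> a * (f * ln f - f * ln g - f + g) + (f + g) / (2 * a)"
  proof (rule add_mono)
    show "a * (u - v)\<^sup>2 \<le> a * (f * ln f - f * ln g - f + g)" using ent a by simp
    have "(u + v)\<^sup>2 \<le> 2 * (f + g)" using uv(3,4) sum_squares_bound[of u v] by (simp add: power2_sum)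
    then have "(u + v)\<^sup>2 / (4 * a) \<le> 2 * (f + g) / (4 * a)" using a by (intro divide_right_mono) auto
    then show "(u + v)\<^sup>2 / (4 * a) \<le> (f + g) / (2 * a)" using a by (simp add: field_simps)
  qed
  finally show ?thesis .
qed

text \<open>The choice of the parameter that balances the two terms of the pointwise bound.\<close>

lemma integral_abs_diff_le_sqrt_entropy:
  fixes f g :: "'a \<Rightarrow> real"
  assumes int: "integrable M f" "integrable M g" "integrable M (\<lambda>x. f x * ln (f x) - f x * ln (g x))"
    and pos: "\<And>x. x \<in> space M \<Longrightarrow> f x \<ge> 0" "\<And>x. x \<in> space M \<Longrightarrow> g x > 0"
    and one: "(\<integral>x. f x \<partial>M) = 1" "(\<integral>x. g x \<partial>M) = 1"
    and B: "B > 0" "(\<integral>x. f x * ln (f x) - f x * ln (g x) \<partial>M) \<le> B"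
  shows "(\<integral>x. \<bar>f x - g x\<bar> \<partial>M) \<le> 2 * sqrt B"
proof -
  \<comment> \<open>This \<open>a\<close> minimises \<open>a * B + 1 / a\<close>.\<close>
  define a where "a = 1 / sqrt B"
  have a: "a > 0" using B by (simp add: a_def)
  define h where "h = (\<lambda>x. f x * ln (f x) - f x * ln (g x))"
  have h: "integrable M h" using int(3) by (simp add: h_def)
  have "(\<integral>x. \<bar>f x - g x\<bar> \<partial>M) \<le> (\<integral>x. a * (h x - f x + g x) + (f x + g x) / (2 * a) \<partial>M)"
    using int(1,2) h pos a abs_diff_le_entropy unfolding h_def
    by (intro integral_mono) (auto simp flip: h_def)
  also have "\<dots> = a * ((\<integral>x. h x \<partial>M) - 1 + 1) + (1 + 1) / (2 * a)"
    using int(1,2) h by (simp add: one)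
  also have "\<dots> \<le> a * B + 1 / a" using B(2) a by (simp add: h_def)
  also have "\<dots> = 2 * sqrt B" using B by (simp add: a_def real_div_sqrt)
  finally show ?thesis .
qed

lemma tv_norm_cong:
  assumes "sets M = sets N" "\<And>A. A \<in> sets M \<Longrightarrow> \<nu> A = \<nu>' A"
  shows "tv_norm M \<nu> = tv_norm N \<nu>'"
proof -
  have sp: "space M = space N" using assms(1) by (rule sets_eq_imp_space_eq)
  show ?thesis unfolding tv_norm_def assms(1)[symmetric] sp[symmetric]
    by (intro SUP_cong refl sum.cong) (use assms in auto)
qed

text \<open>
  A deterministic map does not increase the total variation norm, because preimages turn partitions
  into partitions, apart from empty preimages, where \<open>\<nu>\<close> vanishes.
\<close>

lemma tv_norm_vimage_le:
  assumes r: "r \<in> K \<rightarrow>\<^sub>M N" and \<nu>: "\<nu> {} = 0"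
  shows "tv_norm N (\<lambda>A. \<nu> (r -` A \<inter> space K)) \<le> tv_norm K \<nu>"
  unfolding tv_norm_def
proof (rule SUP_least)
  fix \<A> assume "\<A> \<in> {\<A>. finite \<A> \<and> \<A> \<subseteq> sets N \<and> partition_on (space N) \<A>}"
  then have A: "finite \<A>" "\<A> \<subseteq> sets N" "partition_on (space N) \<A>" by auto
  let ?v = "\<lambda>A. r -` A \<inter> space K"
  \<comment> \<open>Members with an empty preimage would violate the definition of a partition.\<close>
  define \<A>' where "\<A>' = {A \<in> \<A>. ?v A \<noteq> {}}"
  have disj: "A = B" if "A \<in> \<A>" "B \<in> \<A>" "x \<in> A" "x \<in> B" for A B x
    using partition_onD2[OF A(3)] that by (auto simp: disjoint_def)
  have inj: "inj_on ?v \<A>'"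
  proof (rule inj_onI)
    fix A B assume AB: "A \<in> \<A>'" "B \<in> \<A>'" "?v A = ?v B"
    then obtain x where "x \<in> ?v A" by (auto simp: \<A>'_def)
    then have "r x \<in> A" "r x \<in> B" using AB(3) by auto
    then show "A = B" using disj AB by (auto simp: \<A>'_def)
  qed
  have "(\<Sum>A\<in>\<A>. ennreal \<bar>\<nu> (?v A)\<bar>) = (\<Sum>A\<in>\<A>'. ennreal \<bar>\<nu> (?v A)\<bar>)"
    using A(1) \<nu> by (intro sum.mono_neutral_right) (auto simp: \<A>'_def)
  also have "\<dots> = (\<Sum>A\<in>?v ` \<A>'. ennreal \<bar>\<nu> A\<bar>)" by (simp add: sum.reindex[OF inj])
  also have "\<dots> \<le> (SUP \<A> \<in> {\<A>. finite \<A> \<and> \<A> \<subseteq> sets K \<and> partition_on (space K) \<A>}. \<Sum>A\<in>\<A>. ennreal \<bar>\<nu> A\<bar>)" (is "_ \<le> ?S")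
  proof (rule SUP_upper, intro CollectI conjI)
    show "finite (?v ` \<A>')" using A(1) by (simp add: \<A>'_def)
    show "?v ` \<A>' \<subseteq> sets K" using A(2) r by (auto simp: \<A>'_def)
    show "partition_on (space K) (?v ` \<A>')"
    proof (rule partition_onI)
      show "\<Union> (?v ` \<A>') = space K"
      proof
        show "space K \<subseteq> \<Union> (?v ` \<A>')"
        proof
          fix x assume x: "x \<in> space K"
          then have "r x \<in> \<Union>\<A>" using r partition_onD1[OF A(3)] measurable_space by metis
          then show "x \<in> \<Union> (?v ` \<A>')" using x by (auto simp: \<A>'_def)
        qed
      qed auto
      show "disjnt p q" if "p \<in> ?v ` \<A>'" "q \<in> ?v ` \<A>'" "p \<noteq> q" for p q
        using that disj by (auto simp: \<A>'_def disjnt_def)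
      show "{} \<notin> ?v ` \<A>'" by (auto simp: \<A>'_def)
    qed
  qed
  finally show "(\<Sum>A\<in>\<A>. ennreal \<bar>\<nu> (?v A)\<bar>) \<le> ?S" .
qed

lemma measure_density_integral:
  fixes f :: "'a \<Rightarrow> real"
  assumes f: "integrable M f" "\<And>x. x \<in> space M \<Longrightarrow> f x \<ge> 0" and A: "A \<in> sets M"
  shows "measure (density M (\<lambda>x. ennreal (f x))) A = (LINT x:A|M. f x)"
proof -
  have [measurable]: "f \<in> borel_measurable M" using f(1) by auto
  have "emeasure (density M (\<lambda>x. ennreal (f x))) A = (\<integral>\<^sup>+x. ennreal (indicator A x * f x) \<partial>M)"
    using A by (subst emeasure_density) (auto intro!: nn_integral_cong simp: indicator_def)
  also have "\<dots> = ennreal (\<integral>x. indicator A x * f x \<partial>M)"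
    using f integrable_mult_indicator[OF A f(1)] by (intro nn_integral_eq_integral) (auto simp: indicator_def)
  finally have "emeasure (density M (\<lambda>x. ennreal (f x))) A = ennreal (LINT x:A|M. f x)"
    by (simp add: set_lebesgue_integral_def)
  moreover have "0 \<le> (LINT x:A|M. f x)"
    unfolding set_lebesgue_integral_def using f by (intro integral_nonneg_AE AE_I2) (auto simp: indicator_def)
  ultimately show ?thesis by (simp add: measure_def)
qed

lemma tv_norm_density_le:
  fixes f g :: "'a \<Rightarrow> real"
  assumes f: "integrable M f" "\<And>x. x \<in> space M \<Longrightarrow> f x \<ge> 0"
    and g: "integrable M g" "\<And>x. x \<in> space M \<Longrightarrow> g x \<ge> 0"
    and K: "sets K = sets M"
  shows "tv_norm K (\<lambda>A. measure (density M (\<lambda>x. ennreal (f x))) A - measure (density M (\<lambda>x. ennreal (g x))) A)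
    \<le> ennreal (\<integral>x. \<bar>f x - g x\<bar> \<partial>M)"
  unfolding tv_norm_def
proof (rule SUP_least)
  fix \<A> assume "\<A> \<in> {\<A>. finite \<A> \<and> \<A> \<subseteq> sets K \<and> partition_on (space K) \<A>}"
  then have A: "finite \<A>" "\<And>A. A \<in> \<A> \<Longrightarrow> A \<in> sets M" "partition_on (space M) \<A>"
    using K sets_eq_imp_space_eq[OF K] by auto
  have int: "set_integrable M A h" if "integrable M h" "A \<in> \<A>" for A and h :: "'a \<Rightarrow> real"
    unfolding set_integrable_def using integrable_mult_indicator[OF A(2)[OF that(2)] that(1)] .
  have abs: "integrable M (\<lambda>x. \<bar>f x - g x\<bar>)" using f g by auto
  have "(\<Sum>A\<in>\<A>. ennreal \<bar>measure (density M (\<lambda>x. ennreal (f x))) A - measure (density M (\<lambda>x. ennreal (g x))) A\<bar>)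
     \<le> (\<Sum>A\<in>\<A>. ennreal (LINT x:A|M. \<bar>f x - g x\<bar>))"
  proof (intro sum_mono ennreal_leI)
    fix A assume "A \<in> \<A>"
    note AA = A(2)[OF this] int[OF _ this]
    have "measure (density M (\<lambda>x. ennreal (f x))) A - measure (density M (\<lambda>x. ennreal (g x))) A
       = (LINT x:A|M. f x - g x)"
      using f g AA by (simp add: measure_density_integral)
    also have "\<bar>\<dots>\<bar> \<le> (\<integral>x. \<bar>indicator A x *\<^sub>R (f x - g x)\<bar> \<partial>M)"
      unfolding set_lebesgue_integral_def by (rule integral_abs_bound)
    also have "\<dots> = (LINT x:A|M. \<bar>f x - g x\<bar>)"
      unfolding set_lebesgue_integral_def by (intro Bochner_Integration.integral_cong refl) (simp add: abs_mult)
    finally show "\<bar>measure (density M (\<lambda>x. ennreal (f x))) A - measure (density M (\<lambda>x. ennreal (g x))) A\<bar>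
      \<le> (LINT x:A|M. \<bar>f x - g x\<bar>)" .
  qed
  also have "\<dots> = ennreal (\<Sum>A\<in>\<A>. LINT x:A|M. \<bar>f x - g x\<bar>)"
    unfolding set_lebesgue_integral_def by (intro sum_ennreal integral_nonneg_AE AE_I2) auto
  also have "(\<Sum>A\<in>\<A>. LINT x:A|M. \<bar>f x - g x\<bar>) = (LINT x:(\<Union>A\<in>\<A>. A)|M. \<bar>f x - g x\<bar>)"
    using A int[OF abs] partition_onD2[OF A(3)]
    by (intro set_integral_finite_Union[symmetric]) (auto simp: disjoint_family_on_def disjoint_def)
  also have "\<dots> = (\<integral>x. \<bar>f x - g x\<bar> \<partial>M)"
    using partition_onD1[OF A(3)] set_integral_space[OF abs] by simp
  finally show "(\<Sum>A\<in>\<A>. ennreal \<bar>measure (density M (\<lambda>x. ennreal (f x))) A - measure (density M (\<lambda>x. ennreal (g x))) A\<bar>)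
    \<le> ennreal (\<integral>x. \<bar>f x - g x\<bar> \<partial>M)" .
qed

section \<open>Le Cam distance between a discrete experiment and a dominated one\<close>

text \<open>
  Finitely many disjoint cells of measure one, indexed by the sample space of a discrete experiment.
\<close>

locale unit_cells =
  fixes L :: "'a measure" and G :: "'k set" and b :: "'k \<Rightarrow> 'a set"
  assumes finite_G: "finite G" and G_nonempty: "G \<noteq> {}"
    and disjoint_cells: "disjoint_family_on b G"
    and sets_cell: "k \<in> G \<Longrightarrow> b k \<in> sets L"
    and emeasure_cell: "k \<in> G \<Longrightarrow> emeasure L (b k) = 1"
begin

definition histogram :: "('k \<Rightarrow> real) \<Rightarrow> 'a \<Rightarrow> real" where
  "histogram m y = (\<Sum>k\<in>G. m k * indicator (b k) y)"

text \<open>Outside of all cells the index is an arbitrary element of \<open>G\<close>, so that it is a total map into \<open>G\<close>.\<close>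

definition cell_index :: "'a \<Rightarrow> 'k" where
  "cell_index y = (if \<exists>k\<in>G. y \<in> b k then THE k. k \<in> G \<and> y \<in> b k else SOME k. k \<in> G)"

lemma cell_unique: "k \<in> G \<Longrightarrow> l \<in> G \<Longrightarrow> y \<in> b k \<Longrightarrow> y \<in> b l \<Longrightarrow> k = l"
  using disjoint_cells by (auto simp: disjoint_family_on_def)

lemma cell_index_eq: "k \<in> G \<Longrightarrow> y \<in> b k \<Longrightarrow> cell_index y = k"
  unfolding cell_index_def using cell_unique by auto

lemma cell_index_in: "cell_index y \<in> G"
proof (cases "\<exists>k\<in>G. y \<in> b k")
  case True
  then show ?thesis using cell_index_eq by metis
next
  case False
  then show ?thesis unfolding cell_index_def using some_in_eq G_nonempty by auto
qed

lemma measurable_cell_index [measurable]: "cell_index \<in> L \<rightarrow>\<^sub>M count_space G"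
proof (subst measurable_count_space_eq2[OF finite_G], intro conjI ballI)
  show "cell_index \<in> space L \<rightarrow> G" using cell_index_in by auto
  fix k assume k: "k \<in> G"
  define rest where "rest = (if k = (SOME k. k \<in> G) then space L - (\<Union>l\<in>G. b l) else {})"
  have "cell_index -` {k} \<inter> space L = b k \<union> rest"
  proof (intro equalityI subsetI)
    fix y assume y: "y \<in> cell_index -` {k} \<inter> space L"
    show "y \<in> b k \<union> rest"
    proof (cases "\<exists>l\<in>G. y \<in> b l")
      case True
      then show ?thesis using cell_index_eq y by auto
    next
      case False
      then have "k = (SOME k. k \<in> G)" using y by (auto simp: cell_index_def)
      then show ?thesis using False y by (auto simp: rest_def)
    qed
  next
    fix y assume y: "y \<in> b k \<union> rest"
    then show "y \<in> cell_index -` {k} \<inter> space L"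
    proof
      assume "y \<in> b k"
      then show ?thesis using cell_index_eq[OF k] sets.sets_into_space[OF sets_cell[OF k]] by auto
    next
      assume "y \<in> rest"
      then show ?thesis by (auto simp: rest_def cell_index_def split: if_splits)
    qed
  qed
  moreover have "rest \<in> sets L" unfolding rest_def using finite_G sets_cell by auto
  ultimately show "cell_index -` {k} \<inter> space L \<in> sets L" using sets_cell[OF k] by simp
qed

lemma integrable_cell [simp]: "k \<in> G \<Longrightarrow> integrable L (\<lambda>y. indicator (b k) y :: real)"
  using sets_cell emeasure_cell by (simp add: integrable_real_indicator)

lemma integrable_histogram: "integrable L (histogram m)"
  unfolding histogram_def by (intro Bochner_Integration.integrable_sum integrable_mult_right) simp

lemma integral_histogram: "(\<integral>y. histogram m y \<partial>L) = (\<Sum>k\<in>G. m k)"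
proof -
  have "measure L (b k) = 1" if "k \<in> G" for k using emeasure_cell[OF that] by (simp add: measure_def)
  then show ?thesis unfolding histogram_def
    by (subst Bochner_Integration.integral_sum) (auto intro!: sum.cong simp: sets_cell)
qed

lemma histogram_nonneg: "(\<And>k. k \<in> G \<Longrightarrow> m k \<ge> 0) \<Longrightarrow> histogram m y \<ge> 0"
  unfolding histogram_def by (intro sum_nonneg) auto

lemma histogram_cell: "k \<in> G \<Longrightarrow> y \<in> b k \<Longrightarrow> histogram m y = m k"
  unfolding histogram_def using cell_unique finite_G
  by (subst sum.cong[OF refl, where h = "\<lambda>l. if l = k then m k else 0"]) (auto simp: indicator_def)

lemma jitter_measurable:
  assumes K: "sets K = sets L"
  shows "(\<lambda>k. uniform_measure L (b k)) \<in> count_space G \<rightarrow>\<^sub>M prob_algebra K"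
proof (subst measurable_count_space_eq1, rule funcsetI)
  fix k assume k: "k \<in> G"
  have "prob_space (uniform_measure L (b k))" using emeasure_cell[OF k] by (intro prob_space_uniform_measure) auto
  then show "uniform_measure L (b k) \<in> space (prob_algebra K)" using K by (simp add: space_prob_algebra)
qed

lemma point_measure_bind_jitter:
  assumes m: "\<And>k. k \<in> G \<Longrightarrow> m k \<ge> 0"
  shows "point_measure G (\<lambda>k. ennreal (m k)) \<bind> (\<lambda>k. uniform_measure L (b k)) = density L (\<lambda>y. ennreal (histogram m y))"
proof (rule measure_eqI)
  let ?P = "point_measure G (\<lambda>k. ennreal (m k))"
  have ne: "space ?P \<noteq> {}" using G_nonempty by (simp add: space_point_measure)
  have meas: "(\<lambda>k. uniform_measure L (b k)) \<in> ?P \<rightarrow>\<^sub>M subprob_algebra L"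
    using measurable_prob_algebraD[OF jitter_measurable[OF refl]]
    by (simp add: measurable_cong_sets[OF sets_point_measure_count_space refl])
  show s: "sets (?P \<bind> (\<lambda>k. uniform_measure L (b k))) = sets (density L (\<lambda>y. ennreal (histogram m y)))"
    using sets_bind[OF _ ne] by (simp add: sets_bind[of _ _ L] ne)
  fix A assume "A \<in> sets (?P \<bind> (\<lambda>k. uniform_measure L (b k)))"
  then have A: "A \<in> sets L" using s by simp
  have [measurable]: "histogram m \<in> borel_measurable L" using integrable_histogram by auto
  have "emeasure (?P \<bind> (\<lambda>k. uniform_measure L (b k))) A = (\<integral>\<^sup>+k. emeasure (uniform_measure L (b k)) A \<partial>?P)"
    by (rule emeasure_bind[OF ne meas A])
  also have "\<dots> = (\<Sum>k\<in>G. ennreal (m k) * emeasure (uniform_measure L (b k)) A)"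
    using finite_G by (rule nn_integral_point_measure_finite)
  also have "\<dots> = (\<Sum>k\<in>G. ennreal (m k) * emeasure L (b k \<inter> A))"
    using A sets_cell emeasure_cell by (intro sum.cong refl) (simp add: divide_ennreal_def)
  also have "\<dots> = (\<Sum>k\<in>G. (\<integral>\<^sup>+y. ennreal (m k) * indicator (b k \<inter> A) y \<partial>L))"
    using A sets_cell by (intro sum.cong refl) (simp add: nn_integral_cmult_indicator)
  also have "\<dots> = (\<integral>\<^sup>+y. (\<Sum>k\<in>G. ennreal (m k) * indicator (b k \<inter> A) y) \<partial>L)"
    using A sets_cell by (intro nn_integral_sum[symmetric]) auto
  also have "\<dots> = (\<integral>\<^sup>+y. ennreal (histogram m y) * indicator A y \<partial>L)"
  proof (intro nn_integral_cong)
    fix y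
    have "ennreal (histogram m y) = (\<Sum>k\<in>G. ennreal (m k * indicator (b k) y))"
      unfolding histogram_def using m by (intro sum_ennreal[symmetric]) auto
    also have "\<dots> = (\<Sum>k\<in>G. ennreal (m k) * indicator (b k) y)"
      by (intro sum.cong refl) (auto split: split_indicator)
    finally have "ennreal (histogram m y) = (\<Sum>k\<in>G. ennreal (m k) * indicator (b k) y)" .
    then show "(\<Sum>k\<in>G. ennreal (m k) * indicator (b k \<inter> A) y) = ennreal (histogram m y) * indicator A y"
      by (simp add: sum_distrib_right indicator_inter_arith mult.assoc)
  qed
  also have "\<dots> = emeasure (density L (\<lambda>y. ennreal (histogram m y))) A"
    using A by (simp add: emeasure_density)
  finally show "emeasure (?P \<bind> (\<lambda>k. uniform_measure L (b k))) A = emeasure (density L (\<lambda>y. ennreal (histogram m y))) A" .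
qed

lemma measure_histogram_vimage:
  assumes m: "\<And>k. k \<in> G \<Longrightarrow> m k \<ge> 0" and A: "A \<subseteq> G"
  shows "measure (density L (\<lambda>y. ennreal (histogram m y))) (cell_index -` A \<inter> space L)
    = measure (point_measure G (\<lambda>k. ennreal (m k))) A"
proof -
  let ?V = "cell_index -` A \<inter> space L"
  have V: "?V \<in> sets L" using measurable_sets[OF measurable_cell_index, of A] A by simp
  have "measure (density L (\<lambda>y. ennreal (histogram m y))) ?V = (LINT y:?V|L. histogram m y)"
    using V m by (intro measure_density_integral integrable_histogram histogram_nonneg)
  also have "\<dots> = (\<integral>y. histogram (\<lambda>k. if k \<in> A then m k else 0) y \<partial>L)"
    unfolding set_lebesgue_integral_def
  proof (rule Bochner_Integration.integral_cong[OF refl])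
    fix y assume y: "y \<in> space L"
    show "indicator ?V y *\<^sub>R histogram m y = histogram (\<lambda>k. if k \<in> A then m k else 0) y"
    proof (cases "\<exists>k\<in>G. y \<in> b k")
      case True
      then obtain k where k: "k \<in> G" "y \<in> b k" by auto
      then show ?thesis using y by (simp add: histogram_cell[OF k] cell_index_eq[OF k] indicator_def)
    next
      case False
      then show ?thesis by (simp add: histogram_def indicator_def)
    qed
  qed
  also have "\<dots> = (\<Sum>k\<in>A. m k)"
    using A finite_G by (simp add: integral_histogram sum.If_cases Int_absorb1)
  also have "\<dots> = measure (point_measure G (\<lambda>k. ennreal (m k))) A"
  proof -
    have "emeasure (point_measure G (\<lambda>k. ennreal (m k))) A = ennreal (\<Sum>k\<in>A. m k)"
      using A m by (subst emeasure_point_measure_finite[OF finite_G A]) (auto intro!: sum_ennreal)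
    then show ?thesis using A m by (simp add: measure_def sum_nonneg subset_iff)
  qed
  finally show ?thesis .
qed

lemma histogram_entropy:
  assumes int: "\<And>k. k \<in> G \<Longrightarrow> integrable L (\<lambda>y. indicator (b k) y * ln (g y))"
  shows "integrable L (\<lambda>y. histogram m y * ln (histogram m y) - histogram m y * ln (g y))" (is "integrable L ?h")
    and "(\<integral>y. histogram m y * ln (histogram m y) - histogram m y * ln (g y) \<partial>L)
      = (\<Sum>k\<in>G. m k * (ln (m k) - (\<integral>y. indicator (b k) y * ln (g y) \<partial>L)))"
proof -
  have eq: "?h y = (\<Sum>k\<in>G. m k * (ln (m k) * indicator (b k) y - indicator (b k) y * ln (g y)))" for y
  proof (cases "\<exists>k\<in>G. y \<in> b k")
    case True
    then obtain k where k: "k \<in> G" "y \<in> b k" by auto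
    have "(\<Sum>l\<in>G. m l * (ln (m l) * indicator (b l) y - indicator (b l) y * ln (g y)))
       = (\<Sum>l\<in>G. if l = k then m k * (ln (m k) - ln (g y)) else 0)"
      using cell_unique k by (intro sum.cong) (auto simp: indicator_def)
    then show ?thesis using k finite_G by (simp add: histogram_cell[OF k] algebra_simps)
  next
    case False
    then show ?thesis by (simp add: histogram_def indicator_def)
  qed
  have meas: "measure L (b k) = 1" if "k \<in> G" for k using emeasure_cell[OF that] by (simp add: measure_def)
  show "integrable L ?h" unfolding eq using int by auto
  show "(\<integral>y. ?h y \<partial>L) = (\<Sum>k\<in>G. m k * (ln (m k) - (\<integral>y. indicator (b k) y * ln (g y) \<partial>L)))"
    unfolding eq using int by (subst Bochner_Integration.integral_sum) (auto simp: meas sets_cell intro!: sum.cong)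
qed

text \<open>
  Uniform noise in the cell is the kernel from the discrete to the continuous experiment. The cell
  index is the kernel in the other direction; as it recovers the discrete law from the histogram,
  the second deficiency is bounded by the first total variation distance.
\<close>

lemma le_cam_distance_le_histogram_L1:
  fixes P :: "'p \<Rightarrow> 'k measure" and Q :: "'p \<Rightarrow> 'a measure"
  assumes K: "sets K = sets L"
    and P: "\<And>\<theta>. \<theta> \<in> \<Theta> \<Longrightarrow> P \<theta> = point_measure G (\<lambda>k. ennreal (m \<theta> k))"
    and m: "\<And>\<theta> k. \<theta> \<in> \<Theta> \<Longrightarrow> k \<in> G \<Longrightarrow> m \<theta> k \<ge> 0"
    and Q: "\<And>\<theta>. \<theta> \<in> \<Theta> \<Longrightarrow> Q \<theta> = density L (\<lambda>y. ennreal (g \<theta> y))"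
    and g: "\<And>\<theta>. \<theta> \<in> \<Theta> \<Longrightarrow> integrable L (g \<theta>)" "\<And>\<theta> y. \<theta> \<in> \<Theta> \<Longrightarrow> g \<theta> y \<ge> 0"
    and B: "\<And>\<theta>. \<theta> \<in> \<Theta> \<Longrightarrow> (\<integral>y. \<bar>histogram (m \<theta>) y - g \<theta> y\<bar> \<partial>L) \<le> B"
  shows "le_cam_distance \<Theta> (count_space G) P K Q \<le> ennreal B"
  unfolding le_cam_distance_def
proof (rule max.boundedI)
  have spK: "space K = space L" by (rule sets_eq_imp_space_eq[OF K])
  have rK: "cell_index \<in> K \<rightarrow>\<^sub>M count_space G" using measurable_cell_index by (simp add: measurable_cong_sets[OF K refl])
  show "deficiency \<Theta> (count_space G) P K Q \<le> ennreal B"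
    unfolding deficiency_def
  proof (rule INF_lower2[OF jitter_measurable[OF K]], rule SUP_least)
    fix \<theta> assume \<theta>: "\<theta> \<in> \<Theta>"
    have m\<theta>: "\<And>k. k \<in> G \<Longrightarrow> 0 \<le> m \<theta> k" using m[OF \<theta>] .
    have mix: "point_measure G (\<lambda>k. ennreal (m \<theta> k)) \<bind> (\<lambda>k. uniform_measure L (b k))
        = density L (\<lambda>y. ennreal (histogram (m \<theta>) y))"
      by (rule point_measure_bind_jitter) (rule m\<theta>)
    have "tv_norm K (\<lambda>A. measure (P \<theta> \<bind> (\<lambda>k. uniform_measure L (b k))) A - measure (Q \<theta>) A)
      \<le> ennreal (\<integral>y. \<bar>histogram (m \<theta>) y - g \<theta> y\<bar> \<partial>L)"
      unfolding P[OF \<theta>] Q[OF \<theta>] mix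
      using m\<theta> g[OF \<theta>] by (intro tv_norm_density_le integrable_histogram histogram_nonneg K) auto
    also have "\<dots> \<le> ennreal B" using B[OF \<theta>] by (rule ennreal_leI)
    finally show "tv_norm K (\<lambda>A. measure (P \<theta> \<bind> (\<lambda>k. uniform_measure L (b k))) A - measure (Q \<theta>) A) \<le> ennreal B" .
  qed
  have T: "(\<lambda>y. return (count_space G) (cell_index y)) \<in> K \<rightarrow>\<^sub>M prob_algebra (count_space G)"
    using rK measurable_return_prob_space by (rule measurable_compose)
  show "deficiency \<Theta> K Q (count_space G) P \<le> ennreal B"
    unfolding deficiency_def
  proof (rule INF_lower2[OF T], rule SUP_least)
    fix \<theta> assume \<theta>: "\<theta> \<in> \<Theta>"
    have m\<theta>: "\<And>k. k \<in> G \<Longrightarrow> 0 \<le> m \<theta> k" using m[OF \<theta>] .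
    define \<nu> where "\<nu> = (\<lambda>A. measure (density L (\<lambda>y. ennreal (g \<theta> y))) A - measure (density L (\<lambda>y. ennreal (histogram (m \<theta>) y))) A)"
    have spL: "space L \<noteq> {}"
    proof -
      obtain k where "k \<in> G" using G_nonempty by auto
      then show ?thesis using sets.sets_into_space[OF sets_cell] emeasure_cell[of k] by auto
    qed
    have Qb: "Q \<theta> \<bind> (\<lambda>y. return (count_space G) (cell_index y)) = distr (Q \<theta>) (count_space G) cell_index"
      unfolding Q[OF \<theta>] using spL by (intro bind_return_distr') auto
    have "tv_norm (count_space G) (\<lambda>A. measure (Q \<theta> \<bind> (\<lambda>y. return (count_space G) (cell_index y))) A - measure (P \<theta>) A)
      = tv_norm (count_space G) (\<lambda>A. \<nu> (cell_index -` A \<inter> space K))"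
      unfolding Qb
    proof (rule tv_norm_cong[OF refl])
      fix A assume "A \<in> sets (count_space G)"
      then have A: "A \<subseteq> G" by simp
      have "measure (distr (Q \<theta>) (count_space G) cell_index) A = measure (Q \<theta>) (cell_index -` A \<inter> space L)"
        unfolding Q[OF \<theta>] using A by (subst measure_distr) auto
      moreover have "measure (density L (\<lambda>y. ennreal (histogram (m \<theta>) y))) (cell_index -` A \<inter> space L)
          = measure (P \<theta>) A"
        unfolding P[OF \<theta>] by (rule measure_histogram_vimage[OF _ A]) (rule m\<theta>)
      ultimately show "measure (distr (Q \<theta>) (count_space G) cell_index) A - measure (P \<theta>) A = \<nu> (cell_index -` A \<inter> space K)"
        unfolding \<nu>_def spK by (simp add: Q[OF \<theta>])
    qed
    also have "\<dots> \<le> tv_norm K \<nu>" by (rule tv_norm_vimage_le[OF rK]) (simp add: \<nu>_def)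
    also have "\<dots> \<le> ennreal (\<integral>y. \<bar>g \<theta> y - histogram (m \<theta>) y\<bar> \<partial>L)"
      unfolding \<nu>_def using m[OF \<theta>] g[OF \<theta>]
      by (intro tv_norm_density_le integrable_histogram histogram_nonneg K) auto
    also have "\<dots> \<le> ennreal B" using B[OF \<theta>] by (intro ennreal_leI) (simp add: abs_minus_commute)
    finally show "tv_norm (count_space G) (\<lambda>A. measure (Q \<theta> \<bind> (\<lambda>y. return (count_space G) (cell_index y))) A - measure (P \<theta>) A) \<le> ennreal B" .
  qed
qed

end

section \<open>Averages over unit cubes\<close>

definition lattice_cell :: "nat \<Rightarrow> (nat \<Rightarrow> nat) \<Rightarrow> (nat \<Rightarrow> real) set" where
  "lattice_cell d k = (\<Pi>\<^sub>E i\<in>{..<d}. {real (k i) - 1/2 ..< real (k i) + 1/2})"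

lemma sets_lattice_cell: "lattice_cell d k \<in> sets (Pi\<^sub>M {..<d} (\<lambda>_. lborel))"
  unfolding lattice_cell_def by (intro sets_PiM_I_finite) auto

lemma emeasure_lattice_cell: "emeasure (Pi\<^sub>M {..<d} (\<lambda>_. lborel)) (lattice_cell d k) = 1"
  unfolding lattice_cell_def by (subst lborel_product.emeasure_PiM) auto

lemma unit_cells_lattice:
  "unit_cells (Pi\<^sub>M {..<d} (\<lambda>_. lborel)) (multinomial_grid d N) (lattice_cell d)"
proof
  have "(\<lambda>i\<in>{..<d}. 0) \<in> multinomial_grid d N" by (simp add: multinomial_grid_def)
  then show "multinomial_grid d N \<noteq> {}" by blast
  show "disjoint_family_on (lattice_cell d) (multinomial_grid d N)"
    unfolding disjoint_family_on_def
  proof (intro ballI impI)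
    fix k l assume kl: "k \<in> multinomial_grid d N" "l \<in> multinomial_grid d N" "k \<noteq> l"
    have "k = l" if y: "y \<in> lattice_cell d k" "y \<in> lattice_cell d l" for y
    proof (rule PiE_ext)
      show "k \<in> {..<d} \<rightarrow>\<^sub>E UNIV" "l \<in> {..<d} \<rightarrow>\<^sub>E UNIV" using kl by (auto simp: multinomial_grid_def)
      fix i assume "i \<in> {..<d}"
      then have "y i \<in> {real (k i) - 1/2 ..< real (k i) + 1/2}" "y i \<in> {real (l i) - 1/2 ..< real (l i) + 1/2}"
        using y unfolding lattice_cell_def by (blast dest: PiE_mem)+
      then show "k i = l i" by auto
    qed
    then show "lattice_cell d k \<inter> lattice_cell d l = {}" using kl(3) by blast
  qed
qed (auto simp: sets_lattice_cell emeasure_lattice_cell)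

lemma has_bochner_integral_unit_interval_quadratic:
  fixes u \<alpha> \<beta> \<gamma> :: real
  shows "has_bochner_integral lborel (\<lambda>y. indicator {u - 1/2 ..< u + 1/2} y * (\<alpha> + \<beta> * (y - u) + \<gamma> * (y - u)\<^sup>2)) (\<alpha> + \<gamma> / 12)"
proof -
  define F where "F = (\<lambda>y. \<alpha> * y + \<beta> * (y - u)\<^sup>2 / 2 + \<gamma> * (y - u) ^ 3 / 3)"
  let ?f = "\<lambda>y. \<alpha> + \<beta> * (y - u) + \<gamma> * (y - u)\<^sup>2"
  have "has_bochner_integral lborel (\<lambda>y. ?f y * indicator {u - 1/2 .. u + 1/2} y) (F (u + 1/2) - F (u - 1/2))"
  proof (rule has_bochner_integral_FTC_Icc_real)
    fix y show "(F has_real_derivative ?f y) (at y)" unfolding F_def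
      by (auto intro!: derivative_eq_intros)
    show "isCont ?f y" by (intro continuous_intros)
  qed simp
  moreover have "F (u + 1/2) - F (u - 1/2) = \<alpha> + \<gamma> / 12"
    by (simp add: F_def power2_eq_square power3_eq_cube field_simps)
  moreover have "AE y in lborel. ?f y * indicator {u - 1/2 .. u + 1/2} y = indicator {u - 1/2 ..< u + 1/2} y * ?f y"
    using AE_lborel_singleton[of "u + 1/2"] by eventually_elim (auto simp: indicator_def)
  ultimately show ?thesis
    by (subst (asm) has_bochner_integral_cong_AE[where g = "\<lambda>y. indicator {u - 1/2 ..< u + 1/2} y * ?f y"]) auto
qed

text \<open>The coordinates of a uniform point of a unit cube are independent with variance $1/12$.\<close>

lemma lattice_cell_product_moment:
  fixes \<mu> :: "nat \<Rightarrow> real"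
  assumes ij: "i < d" "j < d"
  shows "has_bochner_integral (Pi\<^sub>M {..<d} (\<lambda>_. lborel))
    (\<lambda>x. indicator (lattice_cell d k) x * ((x i - \<mu> i) * (x j - \<mu> j)))
    ((k i - \<mu> i) * (k j - \<mu> j) + (if i = j then 1/12 else 0))"
proof -
  let ?I = "\<lambda>l. {real (k l) - 1/2 ..< real (k l) + 1/2}"
  let ?t = "\<lambda>l y. (if l = i then y - \<mu> i else 1) * (if l = j then y - \<mu> j else 1)"
  define h where "h = (\<lambda>l y. indicator (?I l) y * ?t l y)"
  define c where "c = (\<lambda>l. ?t l (real (k l)) + (if l = i \<and> l = j then 1/12 else 0))"
  have h: "has_bochner_integral lborel (h l) (c l)" for l
  proof -
    define v where "v = real (k l)"
    define B where "B = (if l = i then 1 else 0) * (if l = j then v - \<mu> j else 1)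
      + (if l = j then 1 else 0) * (if l = i then v - \<mu> i else 1)"
    define C where "C = (if l = i \<and> l = j then 1 else 0 :: real)"
    have eq: "?t l y = ?t l v + B * (y - v) + C * (y - v)\<^sup>2" for y
      by (auto simp: B_def C_def power2_eq_square algebra_simps)
    have "c l = ?t l v + C / 12" by (simp add: c_def C_def v_def)
    moreover have "h l = (\<lambda>y. indicator {v - 1/2 ..< v + 1/2} y * (?t l v + B * (y - v) + C * (y - v)\<^sup>2))"
      unfolding h_def v_def[symmetric] eq[symmetric] ..
    ultimately show ?thesis using has_bochner_integral_unit_interval_quadratic[of v "?t l v" B C] by simp
  qed
  have prodt: "(\<Prod>l<d. ?t l (x l)) = (x i - \<mu> i) * (x j - \<mu> j)" for x :: "nat \<Rightarrow> real"
    using ij by (simp add: prod.distrib)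
  have "integrable (Pi\<^sub>M {..<d} (\<lambda>_. lborel)) (\<lambda>x. \<Prod>l<d. h l (x l))"
    by (intro lborel_product.product_integrable_prod integrable.intros[OF h]) auto
  moreover have "(\<integral>x. (\<Prod>l<d. h l (x l)) \<partial>Pi\<^sub>M {..<d} (\<lambda>_. lborel)) = (\<Prod>l<d. c l)"
    by (subst lborel_product.product_integral_prod)
      (auto intro: integrable.intros[OF h] simp: has_bochner_integral_integral_eq[OF h])
  ultimately have "has_bochner_integral (Pi\<^sub>M {..<d} (\<lambda>_. lborel)) (\<lambda>x. \<Prod>l<d. h l (x l)) (\<Prod>l<d. c l)"
    by (simp add: has_bochner_integral_iff)
  moreover have "(\<Prod>l<d. h l (x l)) = indicator (lattice_cell d k) x * ((x i - \<mu> i) * (x j - \<mu> j))"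
    if x: "x \<in> space (Pi\<^sub>M {..<d} (\<lambda>_. lborel))" for x
  proof -
    have "(\<Prod>l<d. indicator (?I l) (x l) :: real) = indicator (lattice_cell d k) x"
    proof (cases "\<forall>l<d. x l \<in> ?I l")
      case True
      then show ?thesis using x by (auto simp: lattice_cell_def space_PiM PiE_iff indicator_def)
    next
      case False
      then obtain l where l: "l < d" "x l \<notin> ?I l" by auto
      then have "(\<Prod>l<d. indicator (?I l) (x l) :: real) = 0" by (intro prod_zero) (auto simp: indicator_def)
      moreover have "x \<notin> lattice_cell d k" using l unfolding lattice_cell_def by (blast dest: PiE_mem)
      ultimately show ?thesis by simp
    qed
    then show ?thesis unfolding h_def prod.distrib[of "\<lambda>l. indicator (?I l) (x l)"] prodt by simp
  qed
  moreover have "(\<Prod>l<d. c l) = (k i - \<mu> i) * (k j - \<mu> j) + (if i = j then 1/12 else 0)"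
  proof (cases "i = j")
    case True
    have "(\<Prod>l<d. c l) = (\<Prod>l<d. if l = i then (k i - \<mu> i) * (k i - \<mu> i) + 1/12 else 1)"
      using True by (intro prod.cong) (auto simp: c_def)
    then show ?thesis using True ij by simp
  next
    case False
    then have "c = (\<lambda>l. ?t l (real (k l)))" by (auto simp: c_def)
    then show ?thesis using prodt[of "\<lambda>l. real (k l)"] False by simp
  qed
  ultimately show ?thesis by (simp cong: has_bochner_integral_cong)
qed

text \<open>
  The noise shifts the mean of the quadratic form only through its diagonal entries, whence the
  constant is a sum of \<open>d\<close> rather than $d^2$ terms.
\<close>

lemma lattice_cell_cell_form:
  fixes \<mu> a :: "nat \<Rightarrow> real" and c :: real
  shows "has_bochner_integral (Pi\<^sub>M {..<d} (\<lambda>_. lborel))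
    (\<lambda>x. indicator (lattice_cell d k) x * cell_form d a c (\<lambda>i. x i - \<mu> i))
    (cell_form d a c (\<lambda>i. k i - \<mu> i) + (\<Sum>i<d. 1 / a i + 1 / c) / 12)"
proof -
  let ?v = "\<lambda>x i. x i - \<mu> i"
  have form: "cell_form d a c w = (\<Sum>i<d. w i * w i / a i) + (\<Sum>i<d. \<Sum>j<d. w i * w j / c)" for w
    by (simp add: cell_form_def power2_eq_square sum_product sum_divide_distrib)
  have m: "has_bochner_integral (Pi\<^sub>M {..<d} (\<lambda>_. lborel)) (\<lambda>x. indicator (lattice_cell d k) x * (?v x i * ?v x j) / z)
      ((?v k i * ?v k j + (if i = j then 1/12 else 0)) / z)" if "i \<in> {..<d}" "j \<in> {..<d}" for i j and z :: real
    using that by (intro has_bochner_integral_divide_zero lattice_cell_product_moment) auto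
  have "has_bochner_integral (Pi\<^sub>M {..<d} (\<lambda>_. lborel))
    (\<lambda>x. (\<Sum>i<d. indicator (lattice_cell d k) x * (?v x i * ?v x i) / a i)
      + (\<Sum>i<d. \<Sum>j<d. indicator (lattice_cell d k) x * (?v x i * ?v x j) / c))
    ((\<Sum>i<d. (?v k i * ?v k i + (if i = i then 1/12 else 0)) / a i)
      + (\<Sum>i<d. \<Sum>j<d. (?v k i * ?v k j + (if i = j then 1/12 else 0)) / c))"
    by (intro has_bochner_integral_add has_bochner_integral_sum m)
  moreover have "(\<Sum>i<d. indicator (lattice_cell d k) x * (?v x i * ?v x i) / a i)
      + (\<Sum>i<d. \<Sum>j<d. indicator (lattice_cell d k) x * (?v x i * ?v x j) / c)
    = indicator (lattice_cell d k) x * cell_form d a c (?v x)" for x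
    by (simp only: form distrib_left sum_distrib_left times_divide_eq_right)
  moreover have "(\<Sum>i<d. (?v k i * ?v k i + (if i = i then 1/12 else 0)) / a i)
      + (\<Sum>i<d. \<Sum>j<d. (?v k i * ?v k j + (if i = j then 1/12 else 0)) / c)
    = cell_form d a c (?v k) + (\<Sum>i<d. 1 / a i + 1 / c) / 12"
  proof -
    have "(\<Sum>j<d. (?v k i * ?v k j + (if i = j then 1/12 else 0)) / c) = (\<Sum>j<d. ?v k i * ?v k j / c) + 1/12 / c"
      if "i < d" for i
      using that by (simp add: add_divide_distrib sum.distrib sum_divide_distrib[symmetric])
    then have "(\<Sum>i<d. \<Sum>j<d. (?v k i * ?v k j + (if i = j then 1/12 else 0)) / c)
      = (\<Sum>i<d. (\<Sum>j<d. ?v k i * ?v k j / c) + 1/12 / c)" by (intro sum.cong) auto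
    then show ?thesis unfolding form
      by (simp add: add_divide_distrib sum.distrib sum_divide_distrib mult.commute)
  qed
  ultimately show ?thesis by (simp only:)
qed

section \<open>The entropy bound\<close>

text \<open>
  The largest of the $d+1$ cell probabilities is at least $1/(d+1)$, so all of them are at least
  $1/(R(d+1))$.
\<close>

lemma Theta_all_probs:
  assumes p: "p \<in> Theta d R" and d: "d \<ge> 1"
  shows "\<forall>i<d. p i > 0" and "l1_norm d p = (\<Sum>i<d. p i)" and "(\<Sum>i<d. p i) < 1"
    and "(\<Sum>i<Suc d. all_probs d p i) = 1"
    and "\<And>i. i < Suc d \<Longrightarrow> 0 < all_probs d p i" and "\<And>i. i < Suc d \<Longrightarrow> all_probs d p i < 1"
    and "\<And>i. i < Suc d \<Longrightarrow> 1 / all_probs d p i \<le> R * (real d + 1)"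
proof -
  let ?w = "all_probs d p"
  have pi: "p i > 0" "p i < 1" if "i < d" for i using p that by (auto simp: Theta_def PiE_iff)
  then show "\<forall>i<d. p i > 0" by blast
  show l1: "l1_norm d p = (\<Sum>i<d. p i)" unfolding l1_norm_def using pi by (intro sum.cong) (auto simp: less_imp_le)
  show lt: "(\<Sum>i<d. p i) < 1" using p l1 by (simp add: Theta_def)
  have wi: "?w i = p i" if "i < d" for i using that by (simp add: all_probs_def)
  have wd: "?w d = 1 - (\<Sum>i<d. p i)" by (simp add: all_probs_def l1)
  show sum1: "(\<Sum>i<Suc d. ?w i) = 1" using wd wi by simp
  show pos: "0 < ?w i" if "i < Suc d" for i
    using that pi wi wd lt by (cases "i = d") auto
  show "?w i < 1" if "i < Suc d" for i
  proof (cases "i = d")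
    case True
    have "{..<d} \<noteq> {}" using d by (simp add: lessThan_empty_iff)
    then have "(\<Sum>i<d. p i) > 0" using pi by (intro sum_pos) auto
    then show ?thesis using True wd by simp
  next
    case False
    then show ?thesis using that wi pi by simp
  qed
  fix i assume i: "i < Suc d"
  let ?S = "?w ` {..<Suc d}"
  have S: "insert (1 - l1_norm d p) (p ` {..<d}) = ?S"
    using wi wd l1 by (auto simp: lessThan_Suc image_def)
  have ratio: "Max ?S / Min ?S \<le> R" using p unfolding Theta_def mem_Collect_eq S by blast
  have "Min ?S \<in> ?S" by (intro Min_in) auto
  then have Min: "Min ?S > 0" using pos by auto
  have "1 \<le> (\<Sum>i<Suc d. Max ?S)" unfolding sum1[symmetric] by (intro sum_mono Max_ge) auto
  then have "1 \<le> (real d + 1) * Max ?S" by (simp add: algebra_simps)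
  moreover have "Max ?S \<le> R * ?w i"
  proof -
    have "Max ?S \<le> R * Min ?S" using ratio Min by (simp add: divide_le_eq)
    moreover have "R \<ge> 0"
    proof -
      have "0 \<le> Max ?S / Min ?S" using Min Max_ge[of ?S "?w i"] pos[OF i] i
        by (intro divide_nonneg_pos) (auto intro: order_trans less_imp_le)
      then show ?thesis using ratio by simp
    qed
    moreover have "Min ?S \<le> ?w i" using i by (intro Min_le) auto
    ultimately show ?thesis using mult_left_mono order_trans by blast
  qed
  then have "(real d + 1) * Max ?S \<le> (real d + 1) * (R * ?w i)" by (intro mult_left_mono) auto
  ultimately have "1 \<le> (real d + 1) * (R * ?w i)" by (rule order_trans)
  then show "1 / ?w i \<le> R * (real d + 1)" using pos[OF i] by (simp add: divide_le_eq mult_ac)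
qed

text \<open>
  The contribution of a single cell to the entropy: the variance term $\frac12(1-x)$ from Pearson's
  statistic cancels the one in the lower bound of the expectation of $\ln X!$.
\<close>

lemma binomial_cell_entropy_bound:
  fixes x m :: real and N :: nat
  assumes x: "0 < x" "x < 1" and N: "N \<ge> 1"
  defines "m \<equiv> N * x"
  shows "(\<Sum>j\<le>N. Bernstein N j x * (j * ln x - ln (fact j) + (j - m)\<^sup>2 / (2 * m)))
    \<le> m - m * ln N - ln (2 * pi * N) / 2 - ln x / 2 + 1 / m"
proof -
  have m: "m > 0" using assms by simp
  have s1: "(\<Sum>j\<le>N. Bernstein N j x * real j) = m" using sum_k_Bernstein[of N x] by (simp add: mult.commute m_def)
  have "(\<Sum>j\<le>N. Bernstein N j x * (j * ln x - ln (fact j) + (j - m)\<^sup>2 / (2 * m)))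
    = (\<Sum>j\<le>N. ln x * (Bernstein N j x * j) + 1 / (2 * m) * (Bernstein N j x * (j - m)\<^sup>2) - Bernstein N j x * ln (fact j))"
    by (intro sum.cong refl) (simp add: algebra_simps)
  also have "\<dots> = ln x * m + 1 / (2 * m) * (m * (1 - x)) - (\<Sum>j\<le>N. Bernstein N j x * ln (fact j))"
    unfolding sum.distrib sum_subtractf sum_distrib_left[symmetric] s1
      Bernstein_central_moments(2)[of N x, folded m_def] ..
  also have "\<dots> \<le> ln x * m + 1 / (2 * m) * (m * (1 - x))
      - (m * ln m - m + ln m / 2 + ln (2 * pi) / 2 + (1 - x) / 2 - 1 / m)"
    using binomial_expectation_ln_fact_lower[OF x N] unfolding m_def[symmetric] by simp
  also have "\<dots> = m - m * ln N - ln (2 * pi * N) / 2 - ln x / 2 + 1 / m"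
  proof -
    have "ln m = ln N + ln x" "ln (2 * pi * N) = ln (2 * pi) + ln N" using x N by (auto simp: m_def ln_mult)
    then show ?thesis using m by (simp add: field_simps)
  qed
  finally show ?thesis .
qed

text \<open>The density of the normal law with the mean and the covariance matrix of the multinomial law.\<close>

definition gauss_density :: "nat \<Rightarrow> nat \<Rightarrow> (nat \<Rightarrow> real) \<Rightarrow> (nat \<Rightarrow> real) \<Rightarrow> real" where
  "gauss_density d N p x = exp (- cell_form d (\<lambda>i. N * p i) (N * (1 - (\<Sum>i<d. p i))) (\<lambda>i. x i - N * p i) / 2)
       / sqrt ((2 * pi) ^ d * (real N ^ d * ((\<Prod>i<d. p i) * (1 - (\<Sum>i<d. p i)))))"

lemma gauss_density_prob:
  assumes p: "\<forall>i<d. p i > 0" "(\<Sum>i<d. p i) < 1" and N: "N \<ge> 1"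
  shows "gauss_density d N p x > 0"
    and "integrable (Pi\<^sub>M {..<d} (\<lambda>_. lborel)) (gauss_density d N p)"
    and "(\<integral>x. gauss_density d N p x \<partial>Pi\<^sub>M {..<d} (\<lambda>_. lborel)) = 1"
proof -
  let ?L = "Pi\<^sub>M {..<d} (\<lambda>_. lborel) :: (nat \<Rightarrow> real) measure"
  have prod: "(\<Prod>i<d. p i) > 0" using p by (intro prod_pos) auto
  show pos: "gauss_density d N p x > 0" for x
    unfolding gauss_density_def using prod p N by (intro divide_pos_pos) auto
  have [measurable]: "gauss_density d N p \<in> borel_measurable ?L"
    unfolding gauss_density_def cell_form_def by measurable
  have "real N * (1 - (\<Sum>i<d. p i)) + (\<Sum>i<d. real N * p i) = N"
    unfolding sum_distrib_left[symmetric] by (simp add: algebra_simps)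
  then have "real N * (1 - (\<Sum>i<d. p i)) / (real N * (1 - (\<Sum>i<d. p i)) + (\<Sum>i<d. real N * p i)) = 1 - (\<Sum>i<d. p i)"
    using N by simp
  moreover have "(\<Prod>i<d. real N * p i) = real N ^ d * (\<Prod>i<d. p i)" by (simp add: prod.distrib)
  ultimately have one: "(\<integral>\<^sup>+x. ennreal (gauss_density d N p x) \<partial>?L) = 1"
    using nn_integral_gaussian_cell_form[of d "\<lambda>i. N * p i" "N * (1 - (\<Sum>i<d. p i))" "\<lambda>i. N * p i"] p N
    unfolding gauss_density_def by (simp add: mult.assoc)
  show int: "integrable ?L (gauss_density d N p)"
    by (rule integrableI_nonneg) (use pos one in \<open>auto simp: less_imp_le\<close>)
  show "(\<integral>x. gauss_density d N p x \<partial>?L) = 1"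
    using one by (subst integral_eq_nn_integral) (use pos in \<open>auto simp: less_imp_le\<close>)
qed

lemma multinomial_mass_pos:
  assumes w: "\<And>i. i \<in> I \<Longrightarrow> w i > 0"
  shows "multinomial_mass I n w k > 0"
  unfolding multinomial_mass_def using w
  by (intro mult_pos_pos prod_pos divide_pos_pos zero_less_power) auto

lemma ln_multinomial_mass:
  assumes I: "finite I" and w: "\<And>i. i \<in> I \<Longrightarrow> w i > 0"
  shows "ln (multinomial_mass I n w k) = ln (fact n) + (\<Sum>i\<in>I. k i * ln (w i) - ln (fact (k i)))"
proof -
  have pos: "w i ^ k i / fact (k i) > 0" if "i \<in> I" for i
    using w[OF that] by (intro divide_pos_pos zero_less_power) auto
  have "ln (multinomial_mass I n w k) = ln (fact n) + ln (\<Prod>i\<in>I. w i ^ k i / fact (k i))"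
    unfolding multinomial_mass_def using pos by (intro ln_mult_pos prod_pos) auto
  also have "ln (\<Prod>i\<in>I. w i ^ k i / fact (k i)) = (\<Sum>i\<in>I. ln (w i ^ k i / fact (k i)))"
    using I less_imp_neq[OF pos] by (intro ln_prod) (auto simp del: divide_eq_0_iff)
  also have "\<dots> = (\<Sum>i\<in>I. k i * ln (w i) - ln (fact (k i)))"
  proof (rule sum.cong[OF refl])
    fix i assume "i \<in> I"
    then have "w i > 0" by (rule w)
    then show "ln (w i ^ k i / fact (k i)) = k i * ln (w i) - ln (fact (k i))" by (simp add: ln_div ln_realpow)
  qed
  finally show ?thesis .
qed

text \<open>
  Pearson's statistic. The squared total deviation of the first \<open>d\<close> counts is the squared deviation
  of the leftover count.
\<close>

lemma cell_form_all_counts: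
  fixes p :: "nat \<Rightarrow> real" and N :: nat
  assumes k: "k \<in> multinomial_grid d N" and l1: "l1_norm d p = (\<Sum>i<d. p i)"
  shows "cell_form d (\<lambda>i. N * p i) (N * (1 - (\<Sum>i<d. p i))) (\<lambda>i. k i - N * p i)
    = (\<Sum>i<Suc d. (all_counts d N k i - N * all_probs d p i)\<^sup>2 / (N * all_probs d p i))"
proof -
  have wd: "all_probs d p d = 1 - (\<Sum>i<d. p i)" by (simp add: all_probs_def l1)
  have "(\<Sum>i<d. k i) \<le> N" using k by (simp add: multinomial_grid_def)
  then have "(\<Sum>i<d. real (k i) - N * p i) = - (real (all_counts d N k d) - N * all_probs d p d)"
    unfolding sum_subtractf sum_distrib_left[symmetric] wd
    by (simp add: all_counts_def of_nat_diff algebra_simps)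
  then have "(\<Sum>i<d. real (k i) - N * p i)\<^sup>2 = (real (all_counts d N k d) - N * all_probs d p d)\<^sup>2"
    by (simp only: power2_minus)
  moreover have "(\<Sum>i<d. (real (k i) - N * p i)\<^sup>2 / (N * p i))
      = (\<Sum>i<d. (real (all_counts d N k i) - N * all_probs d p i)\<^sup>2 / (N * all_probs d p i))"
    by (intro sum.cong) (auto simp: all_counts_def all_probs_def)
  ultimately show ?thesis by (simp add: cell_form_def wd)
qed

lemma lattice_cell_ln_gauss_density:
  fixes p :: "nat \<Rightarrow> real" and q :: real and N :: nat
  assumes p: "\<forall>i<d. p i > 0" "(\<Sum>i<d. p i) < 1" and N: "N \<ge> 1"
  defines "q \<equiv> 1 - (\<Sum>i<d. p i)"
  shows "has_bochner_integral (Pi\<^sub>M {..<d} (\<lambda>_. lborel))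
    (\<lambda>x. indicator (lattice_cell d k) x * ln (gauss_density d N p x))
    (- (cell_form d (\<lambda>i. N * p i) (N * q) (\<lambda>i. k i - N * p i) + (\<Sum>i<d. 1 / (N * p i) + 1 / (N * q)) / 12
       + ln ((2 * pi) ^ d * (real N ^ d * ((\<Prod>i<d. p i) * q)))) / 2)"
proof -
  let ?L = "Pi\<^sub>M {..<d} (\<lambda>_. lborel) :: (nat \<Rightarrow> real) measure"
  define Z where "Z = (2 * pi) ^ d * (real N ^ d * ((\<Prod>i<d. p i) * q))"
  let ?cf = "\<lambda>x. cell_form d (\<lambda>i. N * p i) (N * q) (\<lambda>i. x i - N * p i)"
  have "(\<Prod>i<d. p i) > 0" using p by (intro prod_pos) auto
  then have Z: "Z > 0" using p N by (simp add: Z_def q_def)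
  have ln_g: "ln (gauss_density d N p x) = - 1/2 * ?cf x + (- ln Z / 2)" for x
    unfolding gauss_density_def q_def[symmetric] Z_def[symmetric] using Z by (simp add: ln_div ln_sqrt)
  have one: "has_bochner_integral ?L (\<lambda>x. indicator (lattice_cell d k) x :: real) 1"
    using has_bochner_integral_real_indicator[OF sets_lattice_cell, of d k] emeasure_lattice_cell[of d k]
    by (simp add: measure_def)
  have "has_bochner_integral ?L
     (\<lambda>x. - 1/2 * (indicator (lattice_cell d k) x * ?cf x) + (- ln Z / 2) * indicator (lattice_cell d k) x)
     (- 1/2 * (?cf (\<lambda>i. real (k i)) + (\<Sum>i<d. 1 / (N * p i) + 1 / (N * q)) / 12) + (- ln Z / 2) * 1)"
    by (intro has_bochner_integral_add has_bochner_integral_mult_right lattice_cell_cell_form one)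
  moreover have "- 1/2 * (indicator (lattice_cell d k) x * ?cf x) + (- ln Z / 2) * indicator (lattice_cell d k) x
     = indicator (lattice_cell d k) x * ln (gauss_density d N p x)" for x
    unfolding ln_g by (simp add: algebra_simps)
  moreover have "- 1/2 * (?cf (\<lambda>i. real (k i)) + (\<Sum>i<d. 1 / (N * p i) + 1 / (N * q)) / 12) + (- ln Z / 2) * 1
     = - (?cf (\<lambda>i. real (k i)) + (\<Sum>i<d. 1 / (N * p i) + 1 / (N * q)) / 12 + ln Z) / 2"
    by (simp add: field_simps)
  ultimately show ?thesis unfolding Z_def by (simp only:)
qed

text \<open>
  The left-hand side is the relative entropy of the jittered multinomial law with respect to the
  normal law. All its terms are explicit except the expected values of $\ln X_i!$.
\<close>

lemma jittered_multinomial_entropy_bound: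
  assumes p: "p \<in> Theta d R" and d: "d \<ge> 1" and N: "N \<ge> 1"
  defines "m \<equiv> \<lambda>k. multinomial_mass {..<Suc d} N (all_probs d p) (all_counts d N k)"
  shows "(\<Sum>k\<in>multinomial_grid d N. m k * (ln (m k)
      - (\<integral>x. indicator (lattice_cell d k) x * ln (gauss_density d N p x) \<partial>Pi\<^sub>M {..<d} (\<lambda>_. lborel))))
    \<le> (5 * R + 1) * (real d)\<^sup>2 / N"
proof -
  let ?L = "Pi\<^sub>M {..<d} (\<lambda>_. lborel) :: (nat \<Rightarrow> real) measure"
  let ?G = "multinomial_grid d N"
  let ?c = "all_counts d N"
  define w where "w = all_probs d p"
  define q where "q = 1 - (\<Sum>i<d. p i)"
  note th = Theta_all_probs[OF p d, folded w_def]
  have q: "w d = q" using th(2) by (auto simp: q_def w_def all_probs_def)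
  have wi: "w i = p i" if "i < d" for i using that by (simp add: w_def all_probs_def)
  have n: "real N > 0" using N by simp
  define Z where "Z = (2 * pi) ^ d * (real N ^ d * ((\<Prod>i<d. p i) * q))"
  define J where "J = (\<Sum>i<d. 1 / (N * p i) + 1 / (N * q)) / 12"
  define \<phi> where "\<phi> = (\<lambda>i (j::nat). j * ln (w i) - ln (fact j) + (j - N * w i)\<^sup>2 / (2 * (N * w i)))"
  define e where "e = R * (real d + 1) / N"
  have total: "(\<Sum>k\<in>?G. m k) = 1"
    using sum_multinomial_grid_marginal[of d d p N "\<lambda>_. 1"] th(4)
    by (simp add: m_def w_def sum_Bernstein del: sum.lessThan_Suc)
  have inv: "1 / (N * w i) \<le> e" if "i < Suc d" for i
  proof -
    have "1 / (N * w i) = 1 / w i / N" by simp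
    also have "\<dots> \<le> e" unfolding e_def using th(7)[OF that] n by (intro divide_right_mono) auto
    finally show ?thesis .
  qed
  have summand: "ln (m k) - (\<integral>x. indicator (lattice_cell d k) x * ln (gauss_density d N p x) \<partial>?L)
      = (ln (fact N) + ln Z / 2 + J / 2) + (\<Sum>i<Suc d. \<phi> i (?c k i))" if k: "k \<in> ?G" for k
  proof -
    have 1: "(\<Sum>i<Suc d. \<phi> i (?c k i)) = (\<Sum>i<Suc d. ?c k i * ln (w i) - ln (fact (?c k i)))
        + (\<Sum>i<Suc d. (?c k i - N * w i)\<^sup>2 / (N * w i)) / 2"
      unfolding \<phi>_def sum.distrib sum_divide_distrib by (simp add: mult.commute mult.left_commute del: sum.lessThan_Suc)
    have 2: "ln (m k) = ln (fact N) + (\<Sum>i<Suc d. ?c k i * ln (w i) - ln (fact (?c k i)))"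
      unfolding m_def w_def by (rule ln_multinomial_mass) (use th(5) w_def in auto)
    have 3: "(\<integral>x. indicator (lattice_cell d k) x * ln (gauss_density d N p x) \<partial>?L)
        = - ((\<Sum>i<Suc d. (?c k i - N * w i)\<^sup>2 / (N * w i)) + J + ln Z) / 2"
      using has_bochner_integral_integral_eq[OF lattice_cell_ln_gauss_density[OF th(1,3) N, of k]]
      unfolding q_def[symmetric] J_def[symmetric] Z_def[symmetric] cell_form_all_counts[OF k th(2), folded q_def w_def] .
    show ?thesis unfolding 1 2 3 by (simp add: field_simps del: sum.lessThan_Suc)
  qed
  \<comment> \<open>Grouped so that the sum over the cells is read off from \<open>\<Sum>i. w i = 1\<close>.\<close>
  have cell: "(\<Sum>j\<le>N. Bernstein N j (w i) * \<phi> i j)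
      \<le> w i * (N - N * ln N) - (ln (w i) / 2) + (e - ln (2 * pi * N) / 2)" if i: "i < Suc d" for i
  proof -
    have "(\<Sum>j\<le>N. Bernstein N j (w i) * \<phi> i j)
        \<le> N * w i - N * w i * ln N - ln (2 * pi * N) / 2 - ln (w i) / 2 + 1 / (N * w i)"
      unfolding \<phi>_def by (rule binomial_cell_entropy_bound[OF th(5)[OF i] th(6)[OF i] N])
    then show ?thesis using inv[OF i] by (simp add: algebra_simps)
  qed
  have "(\<Sum>k\<in>?G. m k * (ln (m k) - (\<integral>x. indicator (lattice_cell d k) x * ln (gauss_density d N p x) \<partial>?L)))
     = (\<Sum>k\<in>?G. (ln (fact N) + ln Z / 2 + J / 2) * m k + (\<Sum>i<Suc d. m k * \<phi> i (?c k i)))"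
  proof (intro sum.cong refl)
    fix k assume "k \<in> ?G"
    then show "m k * (ln (m k) - (\<integral>x. indicator (lattice_cell d k) x * ln (gauss_density d N p x) \<partial>?L))
      = (ln (fact N) + ln Z / 2 + J / 2) * m k + (\<Sum>i<Suc d. m k * \<phi> i (?c k i))"
      unfolding summand[OF \<open>k \<in> ?G\<close>] sum_distrib_left[symmetric] by (simp add: algebra_simps del: sum.lessThan_Suc)
  qed
  also have "\<dots> = (ln (fact N) + ln Z / 2 + J / 2) * (\<Sum>k\<in>?G. m k) + (\<Sum>k\<in>?G. \<Sum>i<Suc d. m k * \<phi> i (?c k i))"
    unfolding sum.distrib by (simp only: sum_distrib_left)
  also have "(\<Sum>k\<in>?G. \<Sum>i<Suc d. m k * \<phi> i (?c k i)) = (\<Sum>i<Suc d. \<Sum>k\<in>?G. m k * \<phi> i (?c k i))"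
    by (rule sum.swap)
  also have "\<dots> = (\<Sum>i<Suc d. \<Sum>j\<le>N. Bernstein N j (w i) * \<phi> i j)"
    using th(4) unfolding m_def w_def by (intro sum.cong refl sum_multinomial_grid_marginal) auto
  also have "\<dots> \<le> (\<Sum>i<Suc d. w i * (N - N * ln N) - ln (w i) / 2 + (e - ln (2 * pi * N) / 2))"
    by (intro sum_mono cell) auto
  also have "\<dots> = (N - N * ln N) - (\<Sum>i<Suc d. ln (w i)) / 2 + (real d + 1) * (e - ln (2 * pi * N) / 2)"
    unfolding sum.distrib sum_subtractf sum_divide_distrib[symmetric] sum_distrib_right[symmetric] th(4)
    by (simp add: algebra_simps del: sum.lessThan_Suc)
  finally have main: "(\<Sum>k\<in>?G. m k * (ln (m k) - (\<integral>x. indicator (lattice_cell d k) x * ln (gauss_density d N p x) \<partial>?L)))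
    \<le> ln (fact N) + ln Z / 2 + J / 2
      + ((N - N * ln N) - (\<Sum>i<Suc d. ln (w i)) / 2 + (real d + 1) * (e - ln (2 * pi * N) / 2))"
    unfolding total by simp
  have lnZ: "ln Z = d * ln (2 * pi * N) + (\<Sum>i<Suc d. ln (w i))"
  proof -
    have wp: "(\<Prod>i<Suc d. w i) > 0" using th(5) by (intro prod_pos) auto
    have "Z = (2 * pi * N) ^ d * (\<Prod>i<Suc d. w i)"
      unfolding Z_def using q wi by (simp add: power_mult_distrib)
    then have "ln Z = ln ((2 * pi * N) ^ d) + ln (\<Prod>i<Suc d. w i)"
      using n wp by (simp only:) (intro ln_mult_pos zero_less_power mult_pos_pos; simp)
    moreover have "ln (\<Prod>i<Suc d. w i) = (\<Sum>i<Suc d. ln (w i))" using th(5) by (intro ln_prod) force+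
    ultimately show ?thesis using n by (simp only: ln_realpow)
  qed
  have J: "J \<le> d * e / 6"
  proof -
    have "(\<Sum>i<d. 1 / (N * p i) + 1 / (N * q)) \<le> (\<Sum>i<d. e + e)"
    proof (intro sum_mono add_mono)
      fix i assume "i \<in> {..<d}"
      then show "1 / (N * p i) \<le> e" using inv[of i] wi[of i] by simp
      show "1 / (N * q) \<le> e" using inv[of d] q by simp
    qed
    then show ?thesis unfolding J_def by simp
  qed
  have lnN: "ln (fact N) \<le> N * ln N - N + ln (2 * pi * N) / 2 + 1 / (4 * N)"
    using ln_fact_upper[OF N] n by (simp add: ln_mult_pos add_divide_distrib)
  have "(\<Sum>k\<in>?G. m k * (ln (m k) - (\<integral>x. indicator (lattice_cell d k) x * ln (gauss_density d N p x) \<partial>?L)))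
    \<le> 1 / (4 * N) + d * e / 12 + (real d + 1) * e"
  proof -
    have "(real d + 1) * (e - ln (2 * pi * N) / 2) = (real d + 1) * e - d * ln (2 * pi * N) / 2 - ln (2 * pi * N) / 2"
      by (simp add: field_simps)
    moreover have "d * e / 6 / 2 = d * e / 12" by simp
    ultimately show ?thesis using main J lnN lnZ by argo
  qed
  also have "\<dots> = (1/4 + R * (real d * (real d + 1) / 12 + (real d + 1)\<^sup>2)) / N"
    using n by (simp add: e_def field_simps power2_eq_square)
  also have "\<dots> \<le> (5 * R + 1) * (real d)\<^sup>2 / N"
  proof (intro divide_right_mono)
    have R: "R \<ge> 0"
    proof -
      have "0 < 1 / w d" using th(5)[of d] by simp
      then have "0 < R * (real d + 1)" using th(7)[of d] by linarith
      then show ?thesis by (simp add: zero_less_mult_iff)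
    qed
    have dd: "real d \<le> (real d)\<^sup>2" "1 \<le> (real d)\<^sup>2" using d self_le_power[of "real d" 2] one_le_power[of "real d" 2] by auto
    have "real d * (real d + 1) / 12 + (real d + 1)\<^sup>2 \<le> 5 * (real d)\<^sup>2"
    proof -
      have eq: "real d * (real d + 1) / 12 + (real d + 1)\<^sup>2 = ((real d)\<^sup>2 + real d) / 12 + (real d)\<^sup>2 + 2 * real d + 1"
        by (simp add: power2_eq_square algebra_simps)
      have "(D + x) / 12 + D + 2 * x + 1 \<le> 5 * D" if "x \<le> D" "1 \<le> D" for x D :: real
        using that by (simp add: field_simps)
      from this[OF dd] show ?thesis unfolding eq .
    qed
    then have "R * (real d * (real d + 1) / 12 + (real d + 1)\<^sup>2) \<le> R * (5 * (real d)\<^sup>2)"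
      using R by (rule mult_left_mono)
    then show "1/4 + R * (real d * (real d + 1) / 12 + (real d + 1)\<^sup>2) \<le> (5 * R + 1) * (real d)\<^sup>2"
      using dd by (simp add: algebra_simps)
  qed (use n in auto)
  finally show ?thesis .
qed

theorem theorem3p2:
  fixes R :: real
  assumes "R > 0"
  shows "\<exists>C>0. \<forall>d N :: nat. d \<ge> 1 \<longrightarrow> N \<ge> 1 \<longrightarrow>
    le_cam_distance (Theta d R)
      (count_space (multinomial_grid d N)) (multinomial_measure d N)
      (Rd d) (\<lambda>p. normal_measure d (\<lambda>i. real N * p i) (real N \<cdot>\<^sub>m multinomial_cov d p))
    \<le> ennreal (C * (real d / sqrt (real N)))"
proof (intro exI[of _ "2 * sqrt (5 * R + 1)"] conjI allI impI)
  show "2 * sqrt (5 * R + 1) > 0" using assms by simp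
  fix d N :: nat assume d: "d \<ge> 1" and N: "N \<ge> 1"
  let ?L = "Pi\<^sub>M {..<d} (\<lambda>_. lborel) :: (nat \<Rightarrow> real) measure"
  interpret cells: unit_cells ?L "multinomial_grid d N" "lattice_cell d" by (rule unit_cells_lattice)
  define m where "m = (\<lambda>p k. multinomial_mass {..<Suc d} N (all_probs d p) (all_counts d N k))"
  define B where "B = (5 * R + 1) * (real d)\<^sup>2 / N"
  have B: "B > 0" using assms d N by (simp add: B_def)
  have "le_cam_distance (Theta d R) (count_space (multinomial_grid d N)) (multinomial_measure d N)
      (Rd d) (\<lambda>p. normal_measure d (\<lambda>i. real N * p i) (real N \<cdot>\<^sub>m multinomial_cov d p)) \<le> ennreal (2 * sqrt B)"
  proof (rule cells.le_cam_distance_le_histogram_L1[where m = m and g = "gauss_density d N"])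
    show "sets (Rd d) = sets ?L" by (rule sets_PiM_cong) auto
  next
    fix p assume p: "p \<in> Theta d R"
    note th = Theta_all_probs[OF p d]
    note g = gauss_density_prob[OF th(1,3) N]
    show "multinomial_measure d N p = point_measure (multinomial_grid d N) (\<lambda>k. ennreal (m p k))"
      unfolding multinomial_measure_def point_measure_def m_def
      by (rule density_cong) (simp, simp, unfold AE_count_space, intro ballI arg_cong[where f = ennreal] multinomial_grid_mass)
    show m: "m p k \<ge> 0" for k
      unfolding m_def by (rule less_imp_le, rule multinomial_mass_pos) (use th(5) in auto)
    show "normal_measure d (\<lambda>i. real N * p i) (real N \<cdot>\<^sub>m multinomial_cov d p) = density ?L (\<lambda>x. ennreal (gauss_density d N p x))"
      unfolding gauss_density_def using th N by (intro normal_measure_multinomial) auto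
    show "integrable ?L (gauss_density d N p)" by (rule g(2))
    show "gauss_density d N p x \<ge> 0" for x using g(1) by (rule less_imp_le)
    have mass: "(\<Sum>k\<in>multinomial_grid d N. m p k) = 1"
      using sum_multinomial_grid_marginal[of d d p N "\<lambda>_. 1"] th(4)
      by (simp add: m_def sum_Bernstein del: sum.lessThan_Suc)
    have int: "integrable ?L (\<lambda>x. indicator (lattice_cell d k) x * ln (gauss_density d N p x))" for k
      by (rule integrable.intros[OF lattice_cell_ln_gauss_density[OF th(1,3) N]])
    show "(\<integral>x. \<bar>cells.histogram (m p) x - gauss_density d N p x\<bar> \<partial>?L) \<le> 2 * sqrt B"
    proof (rule integral_abs_diff_le_sqrt_entropy)
      show "(\<integral>x. cells.histogram (m p) x * ln (cells.histogram (m p) x) - cells.histogram (m p) x * ln (gauss_density d N p x) \<partial>?L) \<le> B"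
        unfolding cells.histogram_entropy(2)[OF int] unfolding m_def B_def
        by (rule jittered_multinomial_entropy_bound[OF p d N])
    qed (use g m B mass int in \<open>auto intro: cells.histogram_nonneg cells.integrable_histogram cells.histogram_entropy(1) simp: cells.integral_histogram\<close>)
  qed
  also have "2 * sqrt B = 2 * sqrt (5 * R + 1) * (real d / sqrt (real N))"
    by (simp add: B_def real_sqrt_mult real_sqrt_divide)
  finally show "le_cam_distance (Theta d R) (count_space (multinomial_grid d N)) (multinomial_measure d N)
      (Rd d) (\<lambda>p. normal_measure d (\<lambda>i. real N * p i) (real N \<cdot>\<^sub>m multinomial_cov d p))
    \<le> ennreal (2 * sqrt (5 * R + 1) * (real d / sqrt (real N)))" .
qed

end
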